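(* Let $p>2$ and let $\mathcal{D}\subset\mathbb{H}$ be open, bounded and connected. If $q_0\in\partial\mathcal{D}$ satisfies the exterior $\mathbb{H}$-corkscrew condition, then $q_0$ is game-regular.
   Context: $\mathbb{H}=(\mathbb{R}^3,* )$ is the first Heisenberg group with $(x,y,z)*(x',y',z')=(x+x',y+y',z+z'+\frac12(xy'-yx'))$. The Korányi gauge is $|(x,y,z)|_K=((x^2+y^2)^2+16z^2)^{1/4}$, the metric is $d(q,q')=|q^{-1}*q'|_K$, $B_r(q)=\{q'\in\mathbb{H}: d(q,q')<r\}$, and the dilations are $\rho_\lambda(x,y,z)=(\lambda x,\lambda y,\lambda^2z)$. Set $d_\epsilon(q)=\frac1\epsilon\min\{\epsilon,\mathrm{dist}(q,\mathbb{H}\setminus\mathcal{D})\}$ with $\mathrm{dist}$ taken with respect to $d$, and $\gamma_p=\big(\frac{p-2}{\pi}\big)^{1/2}$. Exterior $\mathbb{H}$-corkscrew condition at $q_0\in\partial\mathcal{D}$: there exists $\mu\in(0,1)$ such that for all sufficiently small $r>0$ there exists a ball $B_{\mu r}(p_0)$ with $B_{\mu r}(p_0)\subset B_r(q_0)\setminus\mathcal{D}$. Tug of War game with noise on $\mathcal{D}$: let $\Omega_1=B_1(0)\times\{1,2,3\}\times(0,1)$ with the product $\mathbb{P}_1$ of normalized Lebesgue measure on $B_1(0)$, uniform measure on $\{1,2,3\}$ and Lebesgue measure on $(0,1)$ (Borel/discrete $\sigma$-algebras), and let $(\Omega,\mathcal{F},\mathbb{P})$ be the countable product of copies of $\Omega_1$,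 with elements $\omega=\{(w_i,s_i,t_i)\}_{i\ge1}$. A strategy of a player is a sequence $\sigma=\{\sigma^n\}_{n\ge0}$ of measurable functions $\sigma^n:H_n\to B_1(0)$ on the spaces of finite histories $H_n=\mathbb{H}\times(\mathbb{H}\times\Omega_1)^n$. Given $\epsilon\in(0,1)$, an initial position $q_0\in\mathbb{H}$ and strategies $\sigma_I,\sigma_{II}$ of the two players, the positions $Q_n=Q_n^{\epsilon,q_0,\sigma_I,\sigma_{II}}:\Omega\to\mathbb{H}$ are: $Q_0=q_0$ and, with $q_k=Q_k$ and $h_{n-1}=(q_0,(q_1,w_1,s_1,t_1),\ldots,(q_{n-1},w_{n-1},s_{n-1},t_{n-1}))\in H_{n-1}$, $$Q_n=\begin{cases}q_{n-1}*\rho_{\gamma_p\epsilon}(\sigma_I^{n-1}(h_{n-1}))*\rho_\epsilon(w_n)& s_n=1\\ q_{n-1}*\rho_{\gamma_p\epsilon}(\sigma_{II}^{n-1}(h_{n-1}))*\rho_\epsilon(w_n)& s_n=2\\ q_{n-1}*\rho_\epsilon(w_n)& s_n=3.\end{cases}$$ The stopping time is $\tau=\tau^{\epsilon,q_0,\sigma_I,\sigma_{II}}=\min\{n\ge1:\ t_n>d_\epsilon(q_{n-1})\}$, which is almost surely finite. A point $q_0\in\partial\mathcal{D}$ is game-regular if for every $\eta,\delta>0$ there exist $\hat\delta\in(0,\delta)$ and $\hat\epsilon\in(0,1)$ such that for every $\epsilon\in(0,\hat\epsilon)$ and every initial position $p_0\in B_{\hat\delta}(q_0)$ there exists a strategy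 $\sigma_{0,I}$ with the property that for every strategy $\sigma_{II}$: $\mathbb{P}\big((Q^{\epsilon,p_0,\sigma_{0,I},\sigma_{II}})_{\tau-1}\in B_\delta(q_0)\big)\ge1-\eta$. *)

theory Defs
  imports "HOL-Probability.Probability" "HOL-Library.Extended_Nat"
begin

text \<open>
  The underlying space is \<open>\<real>\<^sup>3\<close> as an iterated product. Type-class notions on it
  (\<open>open\<close>, \<open>bounded\<close>, \<open>connected\<close>, \<open>frontier\<close>, \<open>borel\<close>, \<open>lborel\<close>) are the Euclidean
  ones; the Koranyi metric induces the same topology and the same bounded sets. Balls and
  distances are always taken with respect to the Koranyi metric.
\<close>

type_synonym heis = "real \<times> real \<times> real"

definition hmul :: "heis \<Rightarrow> heis \<Rightarrow> heis" (infixl "*\<^sub>H" 70) where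
  "hmul = (\<lambda>(x, y, z) (x', y', z'). (x + x', y + y', z + z' + (1 / 2) * (x * y' - y * x')))"

definition hinv :: "heis \<Rightarrow> heis" where
  "hinv = (\<lambda>(x, y, z). (- x, - y, - z))"

lemma hmul_assoc: "(a *\<^sub>H b) *\<^sub>H c = a *\<^sub>H (b *\<^sub>H c)"
  by (cases a, cases b, cases c) (simp add: hmul_def field_simps)

lemma hmul_zero [simp]: "a *\<^sub>H 0 = a" "0 *\<^sub>H a = a"
  by (cases a, simp add: hmul_def zero_prod_def)+

lemma hmul_hinv [simp]: "hinv a *\<^sub>H a = 0" "a *\<^sub>H hinv a = 0"
  by (cases a, simp add: hmul_def hinv_def zero_prod_def)+

definition koranyi :: "heis \<Rightarrow> real" where
  "koranyi = (\<lambda>(x, y, z). root 4 ((x\<^sup>2 + y\<^sup>2)\<^sup>2 + 16 * z\<^sup>2))"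

definition hdist :: "heis \<Rightarrow> heis \<Rightarrow> real" where
  "hdist q q' = koranyi (hinv q *\<^sub>H q')"

definition hball :: "heis \<Rightarrow> real \<Rightarrow> heis set" where
  "hball q r = {q'. hdist q q' < r}"

definition hdil :: "real \<Rightarrow> heis \<Rightarrow> heis" where
  "hdil l = (\<lambda>(x, y, z). (l * x, l * y, l\<^sup>2 * z))"

definition hsetdist :: "heis \<Rightarrow> heis set \<Rightarrow> real" where
  "hsetdist q S = (INF q'\<in>S. hdist q q')"

definition exterior_corkscrew :: "heis set \<Rightarrow> heis \<Rightarrow> bool" where
  "exterior_corkscrew D q0 \<longleftrightarrow>
     (\<exists>\<mu>\<in>{0<..<1}. \<forall>\<^sub>F r in at_right 0. \<exists>p0. hball p0 (\<mu> * r) \<subseteq> hball q0 r - D)"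

type_synonym outcome = "heis \<times> nat \<times> real"

definition Omega1 :: "outcome measure" where
  "Omega1 =
     uniform_measure (restrict_space lborel (hball 0 1)) (hball 0 1) \<Otimes>\<^sub>M
     (uniform_count_measure {1, 2, 3} \<Otimes>\<^sub>M restrict_space lborel {0<..<1})"

definition Omega :: "(nat \<Rightarrow> outcome) measure" where
  "Omega = (\<Pi>\<^sub>M i\<in>{1..}. Omega1)"

text \<open>
  A history of length \<open>n\<close> is a pair of the initial position and a family indexed by
  \<open>{1..n}\<close> (extensional, that is, \<open>undefined\<close> at all other indices).
\<close>

type_synonym history = "heis \<times> (nat \<Rightarrow> heis \<times> outcome)"

type_synonym strategy = "nat \<Rightarrow> history \<Rightarrow> heis"

definition history_space :: "nat \<Rightarrow> history measure" where
  "history_space n = borel \<Otimes>\<^sub>M (\<Pi>\<^sub>M i\<in>{1..n}. borel \<Otimes>\<^sub>M Omega1)"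

definition is_strategy :: "strategy \<Rightarrow> bool" where
  "is_strategy \<sigma> \<longleftrightarrow>
     (\<forall>n. \<sigma> n \<in> measurable (history_space n) (restrict_space borel (hball 0 1)))"

definition gamma_p :: "real \<Rightarrow> real" where
  "gamma_p p = sqrt ((p - 2) / pi)"

lemma restrict_fundef_cong [fundef_cong]:
  "A = B \<Longrightarrow> (\<And>x. x \<in> B \<Longrightarrow> f x = g x) \<Longrightarrow> restrict f A = restrict g B"
  by (auto simp: restrict_def)

fun position :: "real \<Rightarrow> real \<Rightarrow> heis \<Rightarrow> strategy \<Rightarrow> strategy \<Rightarrow> (nat \<Rightarrow> outcome) \<Rightarrow> nat \<Rightarrow> heis"
where
  "position p \<epsilon> q0 \<sigma>I \<sigma>II \<omega> 0 = q0"
| "position p \<epsilon> q0 \<sigma>I \<sigma>II \<omega> (Suc n) =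
    (let q = position p \<epsilon> q0 \<sigma>I \<sigma>II \<omega> n;
         h = (q0, \<lambda>i\<in>{1..n}. (position p \<epsilon> q0 \<sigma>I \<sigma>II \<omega> i, \<omega> i));
         (w, s, t) = \<omega> (Suc n)
     in if s = 1 then q *\<^sub>H hdil (gamma_p p * \<epsilon>) (\<sigma>I n h) *\<^sub>H hdil \<epsilon> w
        else if s = 2 then q *\<^sub>H hdil (gamma_p p * \<epsilon>) (\<sigma>II n h) *\<^sub>H hdil \<epsilon> w
        else q *\<^sub>H hdil \<epsilon> w)"

definition d_eps :: "heis set \<Rightarrow> real \<Rightarrow> heis \<Rightarrow> real" where
  "d_eps D \<epsilon> q = (1 / \<epsilon>) * min \<epsilon> (hsetdist q (- D))"

text \<open>The stopping time takes the value \<open>\<infinity>\<close> where the game never stops.\<close>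

definition stop_time ::
  "heis set \<Rightarrow> real \<Rightarrow> real \<Rightarrow> heis \<Rightarrow> strategy \<Rightarrow> strategy \<Rightarrow> (nat \<Rightarrow> outcome) \<Rightarrow> enat" where
  "stop_time D p \<epsilon> q0 \<sigma>I \<sigma>II \<omega> =
     Inf (enat ` {n. 1 \<le> n \<and>
       snd (snd (\<omega> n)) > d_eps D \<epsilon> (position p \<epsilon> q0 \<sigma>I \<sigma>II \<omega> (n - 1))})"

text \<open>
  Outcomes with infinite stopping time form a null set when \<open>D\<close> is bounded; they are not
  counted in the event below.
\<close>

definition ends_in_ball ::
  "heis set \<Rightarrow> real \<Rightarrow> real \<Rightarrow> heis \<Rightarrow> strategy \<Rightarrow> strategy \<Rightarrow> heis \<Rightarrow> real \<Rightarrow> (nat \<Rightarrow> outcome) set"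
where
  "ends_in_ball D p \<epsilon> p0 \<sigma>I \<sigma>II q0 \<delta> =
     {\<omega> \<in> space Omega. \<exists>n. stop_time D p \<epsilon> p0 \<sigma>I \<sigma>II \<omega> = enat n \<and>
        position p \<epsilon> p0 \<sigma>I \<sigma>II \<omega> (n - 1) \<in> hball q0 \<delta>}"

definition game_regular :: "real \<Rightarrow> heis set \<Rightarrow> heis \<Rightarrow> bool" where
  "game_regular p D q0 \<longleftrightarrow>
     (\<forall>\<eta>>0. \<forall>\<delta>>0. \<exists>\<delta>'\<in>{0<..<\<delta>}. \<exists>\<epsilon>'\<in>{0<..<1}.
        \<forall>\<epsilon>\<in>{0<..<\<epsilon>'}. \<forall>p0\<in>hball q0 \<delta>'.
          \<exists>\<sigma>I. is_strategy \<sigma>I \<and>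
            (\<forall>\<sigma>II. is_strategy \<sigma>II \<longrightarrow>
               measure Omega (ends_in_ball D p \<epsilon> p0 \<sigma>I \<sigma>II q0 \<delta>) \<ge> 1 - \<eta>))"

end

theory Submission
  imports Defs
begin

text \<open>
  Player I pulls towards the exterior balls. Around the centre of such a ball, in rescaled coordinates,
  \<open>1 - exp (- s G)\<close> with \<open>G = (x\<^sup>2 + y\<^sup>2 - k)\<^sup>2 + 16 z\<^sup>2\<close> is a strict supersolution of the
  dynamic programming inequality, for large \<open>s\<close> and small steps. A power of the gauge itself would degenerate
  on the vertical axis, where its horizontal derivatives up to second order vanish.
  Patching rescaled copies over a geometric sequence of radii by taking minima yields a barrier that is
  at most a power \<open>\<theta>\<^sup>n\<close> near \<open>q\<^sub>0\<close> and equals \<open>1\<close> away from \<open>q\<^sub>0\<close>, for some \<open>\<theta> < 1\<close>.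
  Along the game the barrier is a supermartingale, so leaving the ball before stopping is unlikely,
  and the strict decrease per step forces the game to stop.
\<close>

section \<open>The Koranyi gauge\<close>

text \<open>Write \<open>rho^2 = x^2 + y^2\<close>. The squared horizontal gradient of
  \<open>G\<close> is \<open>16 rho^2 G\<close>, and the harmful part of its horizontal Hessian is
  \<open>12 rho^2\<close>: both are multiples of \<open>rho^2\<close>. The exponential weights the
  gradient term by \<open>s\<close>, so wherever \<open>G\<close> is at least \<open>k^2\<close> one
  large \<open>s\<close> beats the Hessian uniformly up to the axis, and the shift leaves a noise
  gain of order \<open>e^2\<close> everywhere. The choice \<open>k = \<mu>\<^sup>2 / 2\<close>
  ensures that \<open>G\<close> is at least \<open>k^2\<close> outside the exterior ball of rescaled
  radius \<mu>. Errors must therefore stay below order \<open>e^2\<close>. Vertical moves enter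
  exactly at that order, so player I has to answer the whole linear part of the expansion and not
  just the gradient. The answer must also be a Borel function of the position, and an exact
  minimiser over the open ball need not exist; a near minimiser with tolerance \<open>e^3\<close> is
  used instead. Since the dynamics commute with left translations and rescale under dilations,
  \<open>s\<close> and the contraction factor are the same at every scale, which is why iteration
  drives the bound to zero.\<close>

lemma koranyi_nonneg: "0 \<le> koranyi q"
  by (cases q) (simp add: koranyi_def)

lemma koranyi_pow4: "koranyi (x, y, z) ^ 4 = (x\<^sup>2 + y\<^sup>2)\<^sup>2 + 16 * z\<^sup>2"
  by (simp add: koranyi_def)

lemma koranyi_sq: "(koranyi (x, y, z))\<^sup>2 = cmod (Complex (x\<^sup>2 + y\<^sup>2) (4 * z))"
proof -
  have "(cmod (Complex (x\<^sup>2 + y\<^sup>2) (4 * z)))\<^sup>2 = ((koranyi (x, y, z))\<^sup>2)\<^sup>2"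
    using koranyi_pow4[of x y z] by (simp add: cmod_power2 power_mult_distrib flip: power_mult)
  then show ?thesis
    by (metis norm_ge_zero power2_eq_iff_nonneg zero_le_power2)
qed

text \<open>With \<open>a = (\<zeta>, t)\<close>, \<open>b = (\<zeta>', t')\<close> and \<open>A = |\<zeta>|\<^sup>2 + 4it\<close>, the product \<open>a b\<close> corresponds to
  \<open>A + B + 2 \<zeta>\<^sup>* \<zeta>'\<close>, where \<open>\<zeta>\<^sup>*\<close> is the conjugate (Cygan).\<close>

lemma koranyi_triangle: "koranyi (a *\<^sub>H b) \<le> koranyi a + koranyi b"
proof (cases a, cases b)
  fix x y z x' y' z' assume ab: "a = (x, y, z)" "b = (x', y', z')"
  let ?A = "Complex (x\<^sup>2 + y\<^sup>2) (4 * z)" and ?B = "Complex (x'\<^sup>2 + y'\<^sup>2) (4 * z')"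
  let ?C = "Complex x (- y) * Complex x' y'"
  have le: "cmod (Complex u v) \<le> koranyi (u, v, w)" for u v w
  proof -
    have "(cmod (Complex u v))\<^sup>2 \<le> (koranyi (u, v, w))\<^sup>2"
      unfolding koranyi_sq cmod_power2 using complex_Re_le_cmod[of "Complex (u\<^sup>2 + v\<^sup>2) (4 * w)"] by simp
    then show ?thesis
      using koranyi_nonneg by (rule power2_le_imp_le)
  qed
  have "cmod (Complex x (- y)) = cmod (Complex x y)"
    by (simp add: cmod_def)
  then have C: "cmod ?C \<le> koranyi a * koranyi b"
    unfolding norm_mult ab by (metis le mult_mono koranyi_nonneg norm_ge_zero)
  have "(koranyi (a *\<^sub>H b))\<^sup>2 = cmod (?A + ?B + 2 * ?C)"
    unfolding ab hmul_def prod.case koranyi_sq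
    by (rule arg_cong[of _ _ cmod]) (simp add: complex_eq_iff power2_eq_square algebra_simps)
  also have "\<dots> \<le> cmod ?A + cmod ?B + 2 * cmod ?C"
    using norm_triangle_ineq[of "?A + ?B" "2 * ?C"] norm_triangle_ineq[of ?A ?B] by (simp add: norm_mult)
  also have "\<dots> \<le> (koranyi a + koranyi b)\<^sup>2"
    using C unfolding ab koranyi_sq[symmetric] by (simp add: power2_sum)
  finally show ?thesis
    by (rule power2_le_imp_le) (simp add: koranyi_nonneg)
qed

lemma koranyi_hinv [simp]: "koranyi (hinv q) = koranyi q"
  by (cases q) (simp add: koranyi_def hinv_def)

lemma koranyi_hdil: "0 \<le> l \<Longrightarrow> koranyi (hdil l q) = l * koranyi q"
proof (cases q)
  fix x y z assume l: "0 \<le> l" and q: "q = (x, y, z)"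
  have "koranyi (hdil l q) ^ 4 = (l * koranyi q) ^ 4"
    unfolding q hdil_def prod.case power_mult_distrib koranyi_pow4
    by (simp add: power2_eq_square power4_eq_xxxx algebra_simps)
  then show ?thesis
    using l koranyi_nonneg by (metis power_eq_imp_eq_base mult_nonneg_nonneg zero_less_numeral)
qed

lemma hinv_hmul: "hinv (a *\<^sub>H b) = hinv b *\<^sub>H hinv a"
  by (cases a, cases b) (simp add: hinv_def hmul_def algebra_simps)

lemma hinv_hinv [simp]: "hinv (hinv a) = a"
  by (cases a) (simp add: hinv_def)

lemma hinv_0 [simp]: "hinv 0 = 0"
  by (simp add: hinv_def zero_prod_def)

lemma hinv_cancel_left [simp]: "hinv a *\<^sub>H (a *\<^sub>H b) = b" "a *\<^sub>H (hinv a *\<^sub>H b) = b"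
  by (simp_all flip: hmul_assoc)

lemma hdil_hmul: "hdil l (a *\<^sub>H b) = hdil l a *\<^sub>H hdil l b"
  by (cases a, cases b) (simp add: hdil_def hmul_def algebra_simps power2_eq_square)

lemma hdil_hdil: "hdil l (hdil m a) = hdil (l * m) a"
  by (cases a) (simp add: hdil_def power_mult_distrib)

lemma hdist_0 [simp]: "hdist 0 q = koranyi q"
  by (simp add: hdist_def)

lemma hdist_self [simp]: "hdist q q = 0"
  by (simp add: hdist_def koranyi_def zero_prod_def)

lemma hdist_nonneg: "0 \<le> hdist q q'"
  by (simp add: hdist_def koranyi_nonneg)

lemma hdist_commute: "hdist q q' = hdist q' q"
  unfolding hdist_def by (metis koranyi_hinv hinv_hmul hinv_hinv)

lemma hdist_triangle: "hdist a c \<le> hdist a b + hdist b c"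
  using koranyi_triangle[of "hinv a *\<^sub>H b" "hinv b *\<^sub>H c"] by (simp add: hdist_def hmul_assoc)

lemma mem_hball_0: "w \<in> hball 0 1 \<longleftrightarrow> koranyi w < 1"
  by (simp add: hball_def)

lemma hball_0_pow4: "(x, y, z) \<in> hball 0 1 \<longleftrightarrow> (x\<^sup>2 + y\<^sup>2)\<^sup>2 + 16 * z\<^sup>2 < 1"
  unfolding mem_hball_0 koranyi_pow4[symmetric]
  by (simp add: power_less_one_iff koranyi_nonneg)

lemma zero_mem_hball_0: "(0::heis) \<in> hball 0 1"
  unfolding mem_hball_0 by (simp add: koranyi_def zero_prod_def)

text \<open>These are the real and imaginary parts of the complex number in
  \<open>koranyi_sq\<close>, each bounded by its modulus.\<close>

lemma koranyi_bounds:
  assumes "koranyi (x, y, z) < c"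
  shows "x\<^sup>2 + y\<^sup>2 \<le> c\<^sup>2" "\<bar>x\<bar> \<le> c" "\<bar>y\<bar> \<le> c" "4 * \<bar>z\<bar> \<le> c\<^sup>2"
proof -
  have c: "0 \<le> c"
    using assms koranyi_nonneg[of "(x, y, z)"] by linarith
  have le: "cmod (Complex (x\<^sup>2 + y\<^sup>2) (4 * z)) \<le> c\<^sup>2"
    unfolding koranyi_sq[symmetric] using assms koranyi_nonneg by (intro power_mono) auto
  show 1: "x\<^sup>2 + y\<^sup>2 \<le> c\<^sup>2"
    using le complex_Re_le_cmod[of "Complex (x\<^sup>2 + y\<^sup>2) (4 * z)"] by simp
  show "4 * \<bar>z\<bar> \<le> c\<^sup>2"
    using le abs_Im_le_cmod[of "Complex (x\<^sup>2 + y\<^sup>2) (4 * z)"] by (simp add: abs_mult)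
  have "x\<^sup>2 \<le> c\<^sup>2" "y\<^sup>2 \<le> c\<^sup>2"
    using 1 zero_le_power2[of x] zero_le_power2[of y] by linarith+
  then show "\<bar>x\<bar> \<le> c" "\<bar>y\<bar> \<le> c"
    using c by (simp_all flip: abs_le_square_iff)
qed

section \<open>Continuity and measurability of the group operations\<close>

lemma continuous_on_hmul [continuous_intros]:
  assumes "continuous_on S f" "continuous_on S g"
  shows "continuous_on S (\<lambda>x. f x *\<^sub>H g x)"
  unfolding hmul_def case_prod_beta by (intro continuous_intros assms)

lemma continuous_on_hinv [continuous_intros]:
  "continuous_on S f \<Longrightarrow> continuous_on S (\<lambda>x. hinv (f x))"
  unfolding hinv_def case_prod_beta by (intro continuous_intros)

lemma continuous_on_hdil [continuous_intros]:
  "continuous_on S f \<Longrightarrow> continuous_on S (\<lambda>x. hdil l (f x))"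
  unfolding hdil_def case_prod_beta by (intro continuous_intros)

lemma continuous_on_koranyi [continuous_intros]:
  "continuous_on S f \<Longrightarrow> continuous_on S (\<lambda>x. koranyi (f x))"
  unfolding koranyi_def case_prod_beta by (intro continuous_intros)

lemma continuous_on_hdist [continuous_intros]:
  "continuous_on S f \<Longrightarrow> continuous_on S g \<Longrightarrow> continuous_on S (\<lambda>x. hdist (f x) (g x))"
  unfolding hdist_def by (intro continuous_intros)

lemma open_hball: "open (hball q r)"
  unfolding hball_def by (intro open_Collect_less continuous_intros)

lemma borel_hball [measurable]: "hball q r \<in> sets borel"
  by (rule borel_open) (rule open_hball)

lemma borel_measurable_hmul [measurable]:
  "f \<in> borel_measurable M \<Longrightarrow> g \<in> borel_measurable M \<Longrightarrow> (\<lambda>x. f x *\<^sub>H g x) \<in> borel_measurable M"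
  by (rule borel_measurable_continuous_Pair[where H=hmul]) (simp_all add: case_prod_beta continuous_on_hmul continuous_on_fst continuous_on_snd)

lemma borel_measurable_hdil [measurable]:
  "f \<in> borel_measurable M \<Longrightarrow> (\<lambda>x. hdil l (f x)) \<in> borel_measurable M"
  by (rule borel_measurable_continuous_on[where f="hdil l"]) (simp_all add: continuous_on_hdil)

section \<open>Moments of the noise\<close>

definition noise :: "heis measure" where
  "noise = uniform_measure (restrict_space lborel (hball 0 1)) (hball 0 1)"

lemma bounded_hball_0: "hball 0 1 \<subseteq> {-1..1} \<times> {-1..1} \<times> {-1..1}"
proof
  fix w assume "w \<in> hball 0 1"
  then show "w \<in> {-1..1} \<times> {-1..1} \<times> {-1..1}"
    using koranyi_bounds[of "fst w" "fst (snd w)" "snd (snd w)" 1]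
    by (auto simp: mem_hball_0 mem_Times_iff abs_le_iff)
qed

text \<open>Positive and finite volume is what makes the normalisation in \<open>noise\<close>
  legitimate.\<close>

lemma emeasure_hball_0: "emeasure lborel (hball 0 1) \<noteq> 0" "emeasure lborel (hball 0 1) \<noteq> \<infinity>"
proof -
  have "\<not> negligible (hball 0 1)"
    using open_not_negligible[OF open_hball] zero_mem_hball_0 by blast
  then show "emeasure lborel (hball 0 1) \<noteq> 0"
    by (simp add: negligible_iff_emeasure0)
  have "emeasure lborel (hball 0 1) \<le> emeasure lborel (cbox (-1, -1, -1) (1, 1, 1) :: heis set)"
    using bounded_hball_0 by (intro emeasure_mono) (simp_all add: cbox_Pair_eq borel_closed closed_Times)
  then show "emeasure lborel (hball 0 1) \<noteq> \<infinity>"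
    using emeasure_lborel_cbox_finite by (auto simp: less_top intro: le_less_trans)
qed

lemma space_noise [simp]: "space noise = hball 0 1"
  by (simp add: noise_def space_restrict_space)

lemma sets_noise: "sets noise = sets (restrict_space borel (hball 0 1))"
  unfolding noise_def sets_uniform_measure by (rule sets_restrict_space_cong) simp

lemma measurable_noise: "f \<in> borel_measurable borel \<Longrightarrow> f \<in> borel_measurable noise"
  unfolding measurable_cong_sets[OF sets_noise refl] by (rule measurable_restrict_space1)

lemma emeasure_noise:
  "A \<in> sets noise \<Longrightarrow> emeasure noise A = emeasure lborel A / emeasure lborel (hball 0 1)"
proof -
  assume A: "A \<in> sets noise"
  then have "A \<subseteq> hball 0 1" "A \<in> sets (restrict_space lborel (hball 0 1))"
    using sets.sets_into_space by (fastforce, simp add: noise_def)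
  moreover have "hball 0 1 \<in> sets (restrict_space lborel (hball 0 1))"
    by (simp add: sets_restrict_space_iff)
  ultimately show ?thesis
    unfolding noise_def by (subst emeasure_uniform_measure)
      (simp_all add: emeasure_restrict_space Int_absorb1)
qed

lemma prob_space_noise: "prob_space noise"
proof
  have "hball 0 1 \<in> sets noise"
    using sets.top[of noise] by simp
  then show "emeasure noise (space noise) = 1"
    using emeasure_hball_0 by (simp add: emeasure_noise ennreal_divide_self less_top)
qed

text \<open>With entries 1 and -1 these diagonal maps preserve the gauge and Lebesgue measure, hence
  \<open>noise\<close>. Symmetry thus replaces explicit integration when moments are shown to
  vanish.\<close>

definition reflect :: "heis \<Rightarrow> heis \<Rightarrow> heis" where
  "reflect = (\<lambda>(a, b, c) (x, y, z). (a * x, b * y, c * z))"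

lemma Basis_heis: "(Basis :: heis set) = {(1, 0, 0), (0, 1, 0), (0, 0, 1)}"
  by (auto simp: Basis_prod_def Basis_real_def zero_prod_def)

lemma lborel_reflect:
  assumes "\<bar>a\<bar> = 1" "\<bar>b\<bar> = 1" "\<bar>c\<bar> = 1"
  shows "distr lborel borel (reflect (a, b, c)) = lborel"
proof -
  have "reflect (a, b, c) = (\<lambda>x. 0 + (\<Sum>j\<in>Basis. (((a, b, c) \<bullet> j) * (x \<bullet> j)) *\<^sub>R j))"
    by (auto simp: reflect_def fun_eq_iff Basis_heis zero_prod_def)
  moreover have "(\<Prod>j\<in>Basis. \<bar>(a, b, c) \<bullet> j\<bar>) = 1"
    using assms by (simp add: Basis_heis)
  moreover have "lborel = density (distr lborel borel (\<lambda>x. 0 + (\<Sum>j\<in>Basis. (((a, b, c) \<bullet> j) * (x \<bullet> j)) *\<^sub>R j)))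
      (\<lambda>_. (\<Prod>j\<in>Basis. \<bar>(a, b, c) \<bullet> j\<bar>))"
    using assms by (intro lborel_affine_euclidean) (auto simp: Basis_heis)
  ultimately show ?thesis
    by (simp add: density_1)
qed

lemma reflect_hball_0_iff:
  assumes "\<bar>a\<bar> = 1" "\<bar>b\<bar> = 1" "\<bar>c\<bar> = 1"
  shows "reflect (a, b, c) w \<in> hball 0 1 \<longleftrightarrow> w \<in> hball 0 1"
proof -
  have "a\<^sup>2 = 1" "b\<^sup>2 = 1" "c\<^sup>2 = 1"
    using assms by (metis power2_abs one_power2)+
  then show ?thesis
    by (cases w) (simp add: reflect_def hball_0_pow4 power_mult_distrib)
qed

lemma borel_measurable_reflect: "reflect v \<in> borel_measurable borel"
  unfolding reflect_def case_prod_beta fst_conv snd_conv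
  by (intro borel_measurable_continuous_onI continuous_intros)

lemma measurable_reflect:
  assumes "\<bar>a\<bar> = 1" "\<bar>b\<bar> = 1" "\<bar>c\<bar> = 1"
  shows "reflect (a, b, c) \<in> measurable noise noise"
  unfolding measurable_cong_sets[OF sets_noise sets_noise]
  by (rule measurable_restrict_space2)
    (simp_all add: space_restrict_space reflect_hball_0_iff[OF assms] measurable_restrict_space1 borel_measurable_reflect)

lemma distr_noise_reflect:
  assumes abc: "\<bar>a\<bar> = 1" "\<bar>b\<bar> = 1" "\<bar>c\<bar> = 1"
  shows "distr noise noise (reflect (a, b, c)) = noise"
proof (rule measure_eqI)
  show "sets (distr noise noise (reflect (a, b, c))) = sets noise"
    by simp
  fix A assume "A \<in> sets (distr noise noise (reflect (a, b, c)))"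
  then have A: "A \<in> sets noise"
    by simp
  then have AB: "A \<subseteq> hball 0 1" "A \<in> sets borel"
    using sets.sets_into_space[OF A] by (simp_all add: sets_noise sets_restrict_space_iff)
  have eq: "reflect (a, b, c) -` A \<inter> space noise = reflect (a, b, c) -` A"
    unfolding space_noise using AB reflect_hball_0_iff[OF abc] by blast
  have "emeasure (distr noise noise (reflect (a, b, c))) A = emeasure noise (reflect (a, b, c) -` A)"
    using emeasure_distr[OF measurable_reflect[OF abc] A] by (simp only: eq)
  also have "\<dots> = emeasure lborel (reflect (a, b, c) -` A) / emeasure lborel (hball 0 1)"
    using measurable_sets[OF measurable_reflect[OF abc] A] unfolding eq by (rule emeasure_noise)
  also have "emeasure lborel (reflect (a, b, c) -` A) = emeasure (distr lborel borel (reflect (a, b, c))) A"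
    using AB by (subst emeasure_distr) (simp_all add: borel_measurable_reflect)
  also have "\<dots> = emeasure lborel A"
    using lborel_reflect[OF abc] by simp
  finally show "emeasure (distr noise noise (reflect (a, b, c))) A = emeasure noise A"
    by (simp add: emeasure_noise[OF A])
qed

text \<open>By invariance of \<open>noise\<close> the integral equals its own negative. A
  non-integrable \<open>f\<close> has Bochner integral 0 by convention, so measurability is
  enough.\<close>

lemma integral_noise_odd:
  fixes f :: "heis \<Rightarrow> real"
  assumes abc: "\<bar>a\<bar> = 1" "\<bar>b\<bar> = 1" "\<bar>c\<bar> = 1" and f: "f \<in> borel_measurable borel"
    and odd: "\<And>w. f (reflect (a, b, c) w) = - f w"
  shows "integral\<^sup>L noise f = 0"
proof -
  have "integral\<^sup>L (distr noise noise (reflect (a, b, c))) f = (\<integral>w. f (reflect (a, b, c) w) \<partial>noise)"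
    by (rule integral_distr) (simp_all add: measurable_noise f measurable_reflect abc)
  then show ?thesis
    using odd by (simp add: distr_noise_reflect[OF abc])
qed

lemma noise_moments:
  "(\<integral>w. fst w \<partial>noise) = 0" "(\<integral>w. fst (snd w) \<partial>noise) = 0"
  "(\<integral>w. snd (snd w) \<partial>noise) = 0" "(\<integral>w. fst w * fst (snd w) \<partial>noise) = 0"
proof -
  have m: "(\<lambda>w::heis. fst w) \<in> borel_measurable borel" "(\<lambda>w::heis. fst (snd w)) \<in> borel_measurable borel"
    "(\<lambda>w::heis. snd (snd w)) \<in> borel_measurable borel"
    "(\<lambda>w::heis. fst w * fst (snd w)) \<in> borel_measurable borel"
    by (rule borel_measurable_continuous_onI,
        simp add: continuous_on_fst continuous_on_snd continuous_on_mult continuous_on_id)+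
  show "(\<integral>w. fst w \<partial>noise) = 0" "(\<integral>w. fst w * fst (snd w) \<partial>noise) = 0"
    by (rule integral_noise_odd[of "-1" 1 1]; simp add: m reflect_def case_prod_beta)+
  show "(\<integral>w. fst (snd w) \<partial>noise) = 0"
    by (rule integral_noise_odd[of 1 "-1" 1]; simp add: m reflect_def case_prod_beta)
  show "(\<integral>w. snd (snd w) \<partial>noise) = 0"
    by (rule integral_noise_odd[of 1 1 "-1"]; simp add: m reflect_def case_prod_beta)
qed

lemma integrable_noise:
  fixes f :: "heis \<Rightarrow> real"
  assumes "f \<in> borel_measurable borel" "\<And>w. w \<in> hball 0 1 \<Longrightarrow> \<bar>f w\<bar> \<le> c"
  shows "integrable noise f"
proof -
  interpret prob_space noise
    by (rule prob_space_noise)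
  show ?thesis
    using assms by (intro integrable_const_bound[of f c] AE_I2) (simp_all add: measurable_noise)
qed

text \<open>The part of the ball where \<open>f\<close> is nonzero is open and nonempty, so it has
  positive measure and the square cannot vanish almost everywhere.\<close>

lemma noise_sq_pos:
  fixes f :: "heis \<Rightarrow> real"
  assumes f: "continuous_on UNIV f" and b: "\<And>w. w \<in> hball 0 1 \<Longrightarrow> \<bar>f w\<bar> \<le> 1"
    and w: "w \<in> hball 0 1" "f w \<noteq> 0"
  shows "0 < (\<integral>w. (f w)\<^sup>2 \<partial>noise)"
proof -
  let ?A = "{w \<in> hball 0 1. f w \<noteq> 0}"
  have "?A = hball 0 1 \<inter> {w. f w \<noteq> 0}"
    by auto
  moreover have "open {w. f w \<noteq> 0}"
    by (intro open_Collect_neq f continuous_intros)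
  ultimately have o: "open ?A"
    by (simp add: open_Int open_hball)
  moreover have "?A \<noteq> {}"
    using w by blast
  ultimately have "\<not> negligible ?A"
    by (rule open_not_negligible)
  moreover have [measurable]: "?A \<in> sets borel"
    using o by (rule borel_open)
  ultimately have "emeasure lborel ?A \<noteq> 0"
    by (simp add: negligible_iff_emeasure0)
  moreover have A: "?A \<in> sets noise"
    using \<open>?A \<in> sets borel\<close> by (auto simp add: sets_noise sets_restrict_space_iff)
  ultimately have nz: "emeasure noise ?A \<noteq> 0"
    using emeasure_hball_0 by (simp add: emeasure_noise)
  have f2: "(\<lambda>w. (f w)\<^sup>2) \<in> borel_measurable borel"
    by (intro borel_measurable_continuous_onI continuous_intros f)
  have i: "integrable noise (\<lambda>w. (f w)\<^sup>2)"
    using f2 by (rule integrable_noise[of _ 1]) (simp add: b abs_square_le_1)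
  show ?thesis
  proof (rule ccontr)
    assume "\<not> ?thesis"
    then have "(\<integral>w. (f w)\<^sup>2 \<partial>noise) = 0"
      by (simp add: antisym_conv integral_nonneg_AE not_less)
    then have "AE w in noise. (f w)\<^sup>2 = 0"
      using integral_nonneg_eq_0_iff_AE[OF i] by simp
    then have "AE w in noise. w \<notin> ?A"
      by (rule eventually_mono) auto
    then have "emeasure noise {w \<in> space noise. w \<in> ?A} = 0"
      using A by (subst (asm) AE_iff_measurable[OF _ refl]) simp_all
    then show False
      using nz by simp
  qed
qed

lemma noise_variance_pos:
  "0 < (\<integral>w. (fst w)\<^sup>2 \<partial>noise)" "0 < (\<integral>w. (fst (snd w))\<^sup>2 \<partial>noise)"
proof -
  have b: "\<bar>fst w\<bar> \<le> 1" "\<bar>fst (snd w)\<bar> \<le> 1" if "w \<in> hball 0 1" for w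
    using koranyi_bounds[of "fst w" "fst (snd w)" "snd (snd w)" 1] that by (auto simp: mem_hball_0)
  have "(1/2, 0, 0) \<in> hball 0 1" "(0, 1/2, 0) \<in> hball 0 1"
    unfolding hball_0_pow4 by (simp_all add: power2_eq_square)
  then show "0 < (\<integral>w. (fst w)\<^sup>2 \<partial>noise)" "0 < (\<integral>w. (fst (snd w))\<^sup>2 \<partial>noise)"
    using noise_sq_pos[of fst] noise_sq_pos[of "\<lambda>w. fst (snd w)"] b
    by (force simp: continuous_on_fst continuous_on_snd continuous_on_id)+
qed

section \<open>Expansion of one move\<close>

text \<open>The odd degree matters: the Lagrange remainder is then an even power with a positive
  coefficient, so the bound holds for both signs of \<open>x\<close>.\<close>

lemma exp_lower_taylor_cubic:
  fixes x :: real
  shows "1 + x + x\<^sup>2 / 2 + x ^ 3 / 6 \<le> exp x"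
proof -
  obtain t where "exp x = (\<Sum>m<4. x ^ m / fact m) + exp t / fact 4 * x ^ 4"
    using Maclaurin_exp_le[of x 4] by blast
  moreover have "(\<Sum>m<4. x ^ m / fact m) = 1 + x + x\<^sup>2 / 2 + x ^ 3 / 6"
    by (simp add: eval_nat_numeral fact_numeral)
  ultimately show ?thesis
    by simp
qed

lemma exp_perturbation_lower:
  fixes e s B L1 L2 L3 L4 :: real
  assumes e: "0 \<le> e" "e \<le> 1" and s: "0 \<le> s"
    and L: "\<bar>L1\<bar> \<le> B" "\<bar>L2\<bar> \<le> B" "\<bar>L3\<bar> \<le> B" "\<bar>L4\<bar> \<le> B"
  shows "1 - s * (e * L1 + e\<^sup>2 * L2) + s\<^sup>2 / 2 * (e\<^sup>2 * L1\<^sup>2) - (2 * s * B + 15 / 2 * s\<^sup>2 * B\<^sup>2 + 32 / 3 * s ^ 3 * B ^ 3) * e ^ 3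
    \<le> exp (- s * (e * L1 + e\<^sup>2 * L2 + e ^ 3 * L3 + e ^ 4 * L4))"
proof -
  define d where "d = e * L1 + e\<^sup>2 * L2 + e ^ 3 * L3 + e ^ 4 * L4"
  have B: "0 \<le> B"
    using L by linarith
  have p: "e\<^sup>2 \<le> e" "e ^ 3 \<le> e\<^sup>2" "e ^ 4 \<le> e ^ 3"
    using e power_decreasing[of 1 2 e] power_decreasing[of 2 3 e] power_decreasing[of 3 4 e] by simp_all
  have t: "\<bar>e * L1\<bar> \<le> e * B" "\<bar>e\<^sup>2 * L2\<bar> \<le> e\<^sup>2 * B" "\<bar>e ^ 3 * L3\<bar> \<le> e ^ 3 * B" "\<bar>e ^ 4 * L4\<bar> \<le> e ^ 4 * B"
    using L e by (simp_all add: abs_mult mult_left_mono)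
  have q: "e\<^sup>2 * B \<le> e * B" "e ^ 3 * B \<le> e\<^sup>2 * B" "e ^ 4 * B \<le> e ^ 3 * B"
    using p B by (auto intro: mult_right_mono)
  have d1: "\<bar>d - (e * L1 + e\<^sup>2 * L2)\<bar> \<le> 2 * (e ^ 3 * B)" and d2: "\<bar>d - e * L1\<bar> \<le> 3 * (e\<^sup>2 * B)"
    and d3: "\<bar>d + e * L1\<bar> \<le> 5 * (e * B)" and d4: "\<bar>d\<bar> \<le> 4 * (e * B)"
    using t q unfolding d_def by linarith+
  \<comment> \<open>Factoring \<open>d^2 - (e L1)^2\<close> makes the error cubic in
    \<open>e\<close>, with 15 = 3 * 5; the cube of \<open>d\<close> below contributes 4^3 / 6 = 32 /
    3.\<close>
  have "\<bar>(d - e * L1) * (d + e * L1)\<bar> \<le> (3 * (e\<^sup>2 * B)) * (5 * (e * B))"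
    unfolding abs_mult using d2 d3 by (intro mult_mono) (auto simp: e B)
  then have sq: "d\<^sup>2 \<ge> e\<^sup>2 * L1\<^sup>2 - 15 * B\<^sup>2 * e ^ 3"
    by (simp add: power2_eq_square power3_eq_cube algebra_simps abs_le_iff)
  have "\<bar>d\<bar> ^ 3 \<le> (4 * (e * B)) ^ 3"
    using d4 by (intro power_mono) auto
  then have cube: "d ^ 3 \<le> 64 * B ^ 3 * e ^ 3"
    by (simp add: power_mult_distrib algebra_simps flip: power_abs)
  have "1 - s * (e * L1 + e\<^sup>2 * L2) - s * (2 * (e ^ 3 * B)) \<le> 1 - s * d"
    using d1 mult_left_mono[OF _ s, of d "e * L1 + e\<^sup>2 * L2 + 2 * (e ^ 3 * B)"] by (simp add: abs_le_iff algebra_simps)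
  moreover have "s\<^sup>2 / 2 * (e\<^sup>2 * L1\<^sup>2 - 15 * B\<^sup>2 * e ^ 3) \<le> s\<^sup>2 / 2 * d\<^sup>2"
    using sq by (intro mult_left_mono) auto
  moreover have "s ^ 3 / 6 * d ^ 3 \<le> s ^ 3 / 6 * (64 * B ^ 3 * e ^ 3)"
    using cube s by (intro mult_left_mono) auto
  moreover have "1 + (- s * d) + (- s * d)\<^sup>2 / 2 + (- s * d) ^ 3 / 6 \<le> exp (- s * d)"
    by (rule exp_lower_taylor_cubic)
  ultimately show ?thesis
    unfolding d_def[symmetric] by (simp add: power_mult_distrib algebra_simps)
qed

text \<open>
  The second horizontal derivatives of \<open>quartic k\<close> are \<open>X\<^sup>2 = Y\<^sup>2 = 12\<rho>\<^sup>2 - 4k\<close> and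
  \<open>XY + YX = 0\<close>, where \<open>\<rho>\<^sup>2 = x\<^sup>2 + y\<^sup>2\<close>. The shift by \<open>k\<close> dents the sublevel sets at the poles:
  at the points where the horizontal gradient vanishes the horizontal Hessian is negative.
\<close>

definition quartic :: "real \<Rightarrow> heis \<Rightarrow> real" where
  "quartic k = (\<lambda>(x, y, z). (x\<^sup>2 + y\<^sup>2 - k)\<^sup>2 + 16 * z\<^sup>2)"

definition quartic_X :: "real \<Rightarrow> heis \<Rightarrow> real" where
  "quartic_X k = (\<lambda>(x, y, z). 4 * ((x\<^sup>2 + y\<^sup>2 - k) * x - 4 * z * y))"

definition quartic_Y :: "real \<Rightarrow> heis \<Rightarrow> real" where
  "quartic_Y k = (\<lambda>(x, y, z). 4 * ((x\<^sup>2 + y\<^sup>2 - k) * y + 4 * z * x))"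

text \<open>Half of the second derivative, which is the coefficient that enters the expansion.\<close>

definition quartic_XX :: "real \<Rightarrow> heis \<Rightarrow> real" where
  "quartic_XX k = (\<lambda>(x, y, z). 6 * (x\<^sup>2 + y\<^sup>2) - 2 * k)"

text \<open>With \<open>u = x^2 + y^2 - k\<close> the horizontal gradient, read as a complex number,
  is \<open>4 (u + 4iz)(x + iy)\<close>, and the modulus is multiplicative. Where
  \<open>quartic\<close> is positive the gradient vanishes only on the axis.\<close>

lemma quartic_grad: "(quartic_X k (x, y, z))\<^sup>2 + (quartic_Y k (x, y, z))\<^sup>2 = 16 * (x\<^sup>2 + y\<^sup>2) * quartic k (x, y, z)"
  by (simp add: quartic_def quartic_X_def quartic_Y_def power2_eq_square algebra_simps)

text \<open>Exact, since \<open>quartic\<close> is a polynomial of weight four. The product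
  \<open>a * b\<close> is absent at second order because its coefficient is the symmetrised
  derivative XY + YX; the vertical derivative \<open>32 * z\<close> appears there because vertical
  displacements have weight two.\<close>

lemma quartic_expand:
  "quartic k ((x, y, z) *\<^sub>H (e * a, e * b, e\<^sup>2 * c)) = quartic k (x, y, z)
    + (e * (quartic_X k (x, y, z) * a + quartic_Y k (x, y, z) * b)
    + e\<^sup>2 * (quartic_XX k (x, y, z) * (a\<^sup>2 + b\<^sup>2) + 32 * z * c)
    + e ^ 3 * (4 * ((x * a + y * b) * (a\<^sup>2 + b\<^sup>2) + 4 * c * (x * b - y * a)))
    + e ^ 4 * ((a\<^sup>2 + b\<^sup>2)\<^sup>2 + 16 * c\<^sup>2))"
  by (simp add: quartic_def quartic_X_def quartic_Y_def quartic_XX_def hmul_def power2_eq_square power3_eq_cube power4_eq_xxxx field_simps)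

lemma integral_noise_quadratic:
  "(\<integral>w. c0 + c1 * fst w + c2 * fst (snd w) + c3 * snd (snd w) + c11 * (fst w)\<^sup>2 + c22 * (fst (snd w))\<^sup>2
      + c12 * (fst w * fst (snd w)) \<partial>noise)
    = c0 + c11 * (\<integral>w. (fst w)\<^sup>2 \<partial>noise) + c22 * (\<integral>w. (fst (snd w))\<^sup>2 \<partial>noise)" (is ?I)
  and integrable_noise_quadratic:
  "integrable noise (\<lambda>w. c0 + c1 * fst w + c2 * fst (snd w) + c3 * snd (snd w) + c11 * (fst w)\<^sup>2 + c22 * (fst (snd w))\<^sup>2
      + c12 * (fst w * fst (snd w)))" (is ?J)
proof -
  interpret prob_space noise
    by (rule prob_space_noise)
  have b: "\<bar>fst w\<bar> \<le> 1" "\<bar>fst (snd w)\<bar> \<le> 1" "\<bar>snd (snd w)\<bar> \<le> 1" if "w \<in> hball 0 1" for w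
    using koranyi_bounds[of "fst w" "fst (snd w)" "snd (snd w)" 1] that by (auto simp: mem_hball_0)
  have b2: "(fst w)\<^sup>2 \<le> 1" "(fst (snd w))\<^sup>2 \<le> 1" "\<bar>fst w * fst (snd w)\<bar> \<le> 1" if "w \<in> hball 0 1" for w
    using b[OF that] by (simp_all add: abs_square_le_1 abs_mult mult_le_one)
  have i: "integrable noise (\<lambda>w. fst w)" "integrable noise (\<lambda>w. fst (snd w))" "integrable noise (\<lambda>w. snd (snd w))"
    "integrable noise (\<lambda>w. (fst w)\<^sup>2)" "integrable noise (\<lambda>w. (fst (snd w))\<^sup>2)"
    "integrable noise (\<lambda>w. fst w * fst (snd w))"
    by (rule integrable_noise[of _ 1], rule borel_measurable_continuous_onI,
        simp add: continuous_on_fst continuous_on_snd continuous_on_mult continuous_on_id continuous_on_power, simp add: b b2)+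
  show ?J
    using i by (intro Bochner_Integration.integrable_add integrable_mult_right integrable_const)
  show ?I
    using i noise_moments prob_space by simp
qed

text \<open>
  The noise average of \<open>exp (- s * quartic k)\<close> after a move \<open>a\<close> of a player is, up to second order, governed
  by \<open>odd_part + even_part\<close>, where \<open>odd_part\<close> is linear in \<open>a\<close>. It contains the vertical
  component of \<open>a\<close>, which competes with the gradient term close to the axis.
\<close>

definition odd_part :: "real \<Rightarrow> real \<Rightarrow> real \<Rightarrow> heis \<Rightarrow> heis \<Rightarrow> real" where
  "odd_part k g e q = (\<lambda>(a, b, c). e * g * (quartic_X k q * a + quartic_Y k q * b) + 32 * e\<^sup>2 * g\<^sup>2 * snd (snd q) * c)"

definition even_part :: "real \<Rightarrow> real \<Rightarrow> real \<Rightarrow> real \<Rightarrow> heis \<Rightarrow> heis \<Rightarrow> real" where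
  "even_part k g s e q = (\<lambda>(a, b, c). e\<^sup>2 * g\<^sup>2 * (quartic_XX k q * (a\<^sup>2 + b\<^sup>2) - s / 2 * (quartic_X k q * a + quartic_Y k q * b)\<^sup>2))"

definition var1 :: real where "var1 = (\<integral>w. (fst w)\<^sup>2 \<partial>noise)"
definition var2 :: real where "var2 = (\<integral>w. (fst (snd w))\<^sup>2 \<partial>noise)"

text \<open>The error constant of \<open>exp_perturbation_lower\<close> with the bound
  \<open>B\<close> of \<open>expansion_bounds\<close> at \<open>K = g + 1\<close>, the largest
  length of a player's move combined with noise, in units of the step.\<close>

definition remainder :: "real \<Rightarrow> real \<Rightarrow> real" where
  "remainder g s = 2 * s * (1000 * (g + 1) ^ 4) + 15 / 2 * s\<^sup>2 * (1000 * (g + 1) ^ 4)\<^sup>2 + 32 / 3 * s ^ 3 * (1000 * (g + 1) ^ 4) ^ 3"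

text \<open>A crude common bound: the estimates in the proof give 720 K, 312 K^2, 144 K^3 and 20 K^4
  for the four coefficients of \<open>quartic_expand\<close>.\<close>

lemma expansion_bounds:
  fixes x y z k K \<alpha> \<beta> \<zeta> :: real
  assumes q: "\<bar>x\<bar> \<le> 3" "\<bar>y\<bar> \<le> 3" "\<bar>z\<bar> \<le> 3" and k: "0 \<le> k" "k \<le> 1"
    and K: "1 \<le> K" and h: "\<bar>\<alpha>\<bar> \<le> K" "\<bar>\<beta>\<bar> \<le> K" "\<bar>\<zeta>\<bar> \<le> K\<^sup>2"
  shows "\<bar>quartic_X k (x, y, z) * \<alpha> + quartic_Y k (x, y, z) * \<beta>\<bar> \<le> 1000 * K ^ 4" (is ?A)
    and "\<bar>quartic_XX k (x, y, z) * (\<alpha>\<^sup>2 + \<beta>\<^sup>2) + 32 * z * \<zeta>\<bar> \<le> 1000 * K ^ 4" (is ?B)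
    and "\<bar>4 * ((x * \<alpha> + y * \<beta>) * (\<alpha>\<^sup>2 + \<beta>\<^sup>2) + 4 * \<zeta> * (x * \<beta> - y * \<alpha>))\<bar> \<le> 1000 * K ^ 4" (is ?C)
    and "\<bar>(\<alpha>\<^sup>2 + \<beta>\<^sup>2)\<^sup>2 + 16 * \<zeta>\<^sup>2\<bar> \<le> 1000 * K ^ 4" (is ?D)
proof -
  have K': "1 \<le> K ^ 3" "K \<le> K ^ 4" "K\<^sup>2 \<le> K ^ 4" "K ^ 3 \<le> K ^ 4"
    using K power_increasing[of 1 4 K] power_increasing[of 2 4 K] power_increasing[of 3 4 K] by simp_all
  have m: "\<bar>a * b\<bar> \<le> c * d" if "\<bar>a\<bar> \<le> c" "\<bar>b\<bar> \<le> d" for a b c d :: real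
    unfolding abs_mult using that by (intro mult_mono) auto
  have sq: "x\<^sup>2 \<le> 9" "y\<^sup>2 \<le> 9" "\<alpha>\<^sup>2 \<le> K\<^sup>2" "\<beta>\<^sup>2 \<le> K\<^sup>2" "0 \<le> x\<^sup>2" "0 \<le> y\<^sup>2" "0 \<le> \<alpha>\<^sup>2" "0 \<le> \<beta>\<^sup>2"
    using abs_le_square_iff[of x 3] abs_le_square_iff[of y 3] abs_le_square_iff[of \<alpha> K] abs_le_square_iff[of \<beta> K] q h K
    by simp_all
  have u: "\<bar>x\<^sup>2 + y\<^sup>2 - k\<bar> \<le> 18"
    using sq k by linarith
  have zx: "\<bar>z * x\<bar> \<le> 9" "\<bar>z * y\<bar> \<le> 9"
    using m[OF q(3) q(1)] m[OF q(3) q(2)] by simp_all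
  have ux: "\<bar>(x\<^sup>2 + y\<^sup>2 - k) * x\<bar> \<le> 54" "\<bar>(x\<^sup>2 + y\<^sup>2 - k) * y\<bar> \<le> 54"
    using m[OF u q(1)] m[OF u q(2)] by simp_all
  have "\<bar>quartic_X k (x, y, z)\<bar> \<le> 360" "\<bar>quartic_Y k (x, y, z)\<bar> \<le> 360"
    using ux zx unfolding quartic_X_def quartic_Y_def by (simp_all add: mult.assoc abs_le_iff)
  then have "\<bar>quartic_X k (x, y, z) * \<alpha>\<bar> \<le> 360 * K" "\<bar>quartic_Y k (x, y, z) * \<beta>\<bar> \<le> 360 * K"
    using m h by blast+
  then show ?A
    using K' K by linarith
  have "\<bar>quartic_XX k (x, y, z)\<bar> \<le> 108"
    unfolding quartic_XX_def prod.case by (rule abs_leI; use sq k in argo)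
  moreover have "\<bar>\<alpha>\<^sup>2 + \<beta>\<^sup>2\<bar> \<le> 2 * K\<^sup>2"
    by (rule abs_leI; use sq in linarith)
  ultimately have hab: "\<bar>quartic_XX k (x, y, z)\<bar> \<le> 108" "\<bar>\<alpha>\<^sup>2 + \<beta>\<^sup>2\<bar> \<le> 2 * K\<^sup>2"
    by -
  have "\<bar>quartic_XX k (x, y, z) * (\<alpha>\<^sup>2 + \<beta>\<^sup>2)\<bar> \<le> 216 * K\<^sup>2"
    using m[OF hab] by simp
  moreover have "\<bar>z * \<zeta>\<bar> \<le> 3 * K\<^sup>2"
    using m[OF q(3) h(3)] .
  ultimately show ?B
    using K' by (simp only: mult.assoc)
  have "\<bar>x * \<alpha>\<bar> \<le> 3 * K" "\<bar>y * \<beta>\<bar> \<le> 3 * K" "\<bar>x * \<beta>\<bar> \<le> 3 * K" "\<bar>y * \<alpha>\<bar> \<le> 3 * K"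
    using m q h by blast+
  then have "\<bar>x * \<alpha> + y * \<beta>\<bar> \<le> 6 * K" "\<bar>x * \<beta> - y * \<alpha>\<bar> \<le> 6 * K"
    by linarith+
  then have "\<bar>(x * \<alpha> + y * \<beta>) * (\<alpha>\<^sup>2 + \<beta>\<^sup>2)\<bar> \<le> 12 * K ^ 3" "\<bar>\<zeta> * (x * \<beta> - y * \<alpha>)\<bar> \<le> 6 * K ^ 3"
    using m[of "x * \<alpha> + y * \<beta>" "6 * K", OF _ hab(2)] m[OF h(3), of "x * \<beta> - y * \<alpha>" "6 * K"]
    by (simp_all add: power2_eq_square power3_eq_cube mult_ac)
  moreover have "\<bar>4 * (P + 4 * \<zeta> * Q)\<bar> \<le> 4 * \<bar>P\<bar> + 16 * \<bar>\<zeta> * Q\<bar>" for P Q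
    unfolding distrib_left mult.assoc by linarith
  ultimately show ?C
    using K' K by (smt (verit))
  have "\<bar>(\<alpha>\<^sup>2 + \<beta>\<^sup>2) * (\<alpha>\<^sup>2 + \<beta>\<^sup>2)\<bar> \<le> 4 * K ^ 4" "\<bar>\<zeta> * \<zeta>\<bar> \<le> K ^ 4"
    using m[OF hab(2) hab(2)] m[OF h(3) h(3)] by (simp_all add: power2_eq_square power4_eq_xxxx mult_ac)
  then show ?D
    using K' K unfolding power2_eq_square[of "_ + _"] power2_eq_square[of \<zeta>] by linarith
qed

lemma quartic_nonneg: "0 \<le> quartic k q"
  by (simp add: quartic_def case_prod_beta)

lemma continuous_on_quartic: "continuous_on S f \<Longrightarrow> continuous_on S (\<lambda>x. quartic k (f x))"
  unfolding quartic_def case_prod_beta by (intro continuous_intros)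

lemma hmul_dilations:
  "hdil (g * e) (a1, a2, a3) *\<^sub>H hdil e (w1, w2, w3) = (e * (g * a1 + w1), e * (g * a2 + w2),
     e\<^sup>2 * (g\<^sup>2 * a3 + w3 + g / 2 * (a1 * w2 - a2 * w1)))"
  by (simp add: hdil_def hmul_def power2_eq_square field_simps)

text \<open>For each fixed noise \<open>w\<close> the exponential dominates a polynomial of degree
  two in \<open>w\<close>. Integration keeps only its constant and square terms, so products of the
  move with the noise average out.\<close>

lemma move_lower:
  fixes g s e k :: real
  assumes q: "\<bar>x\<bar> \<le> 3" "\<bar>y\<bar> \<le> 3" "\<bar>z\<bar> \<le> 3" and k: "0 \<le> k" "k \<le> 1" and a: "(a1, a2, a3) \<in> hball 0 1"
    and g: "0 \<le> g" and s: "0 \<le> s" and e: "0 \<le> e" "e \<le> 1"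
  defines "p \<equiv> (x, y, z)"
  shows "exp (- s * quartic k p) * (1 - s * (odd_part k g e p (a1, a2, a3) + even_part k g s e p (a1, a2, a3))
      + s * e\<^sup>2 * (s / 2 * ((quartic_X k p)\<^sup>2 * var1 + (quartic_Y k p)\<^sup>2 * var2) - quartic_XX k p * (var1 + var2))
      - remainder g s * e ^ 3)
    \<le> (\<integral>w. exp (- s * quartic k (p *\<^sub>H hdil (g * e) (a1, a2, a3) *\<^sub>H hdil e w)) \<partial>noise)"
proof -
  interpret prob_space noise
    by (rule prob_space_noise)
  define L where "L = quartic_X k p * a1 + quartic_Y k p * a2"
  define c0 where "c0 = 1 - s * (e * g * L + e\<^sup>2 * (quartic_XX k p * g\<^sup>2 * (a1\<^sup>2 + a2\<^sup>2) + 32 * z * g\<^sup>2 * a3))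
    + s\<^sup>2 / 2 * e\<^sup>2 * g\<^sup>2 * L\<^sup>2 - remainder g s * e ^ 3"
  define c1 where "c1 = - s * (e * quartic_X k p + e\<^sup>2 * (2 * quartic_XX k p * g * a1 - 16 * z * g * a2)) + s\<^sup>2 * e\<^sup>2 * g * L * quartic_X k p"
  define c2 where "c2 = - s * (e * quartic_Y k p + e\<^sup>2 * (2 * quartic_XX k p * g * a2 + 16 * z * g * a1)) + s\<^sup>2 * e\<^sup>2 * g * L * quartic_Y k p"
  define c3 where "c3 = - s * e\<^sup>2 * 32 * z"
  define c11 where "c11 = - s * e\<^sup>2 * quartic_XX k p + s\<^sup>2 / 2 * e\<^sup>2 * (quartic_X k p)\<^sup>2"
  define c22 where "c22 = - s * e\<^sup>2 * quartic_XX k p + s\<^sup>2 / 2 * e\<^sup>2 * (quartic_Y k p)\<^sup>2"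
  define c12 where "c12 = s\<^sup>2 * e\<^sup>2 * quartic_X k p * quartic_Y k p"
  note cs = c0_def c1_def c2_def c3_def c11_def c22_def c12_def
  let ?P = "\<lambda>w::heis. c0 + c1 * fst w + c2 * fst (snd w) + c3 * snd (snd w) + c11 * (fst w)\<^sup>2 + c22 * (fst (snd w))\<^sup>2
      + c12 * (fst w * fst (snd w))"
  let ?F = "\<lambda>w. exp (- s * quartic k (p *\<^sub>H hdil (g * e) (a1, a2, a3) *\<^sub>H hdil e w))"
  have pw: "exp (- s * quartic k p) * ?P w \<le> ?F w" if w: "w \<in> hball 0 1" for w
  proof -
    obtain w1 w2 w3 where ww: "w = (w1, w2, w3)"
      by (cases w)
    have bw: "\<bar>w1\<bar> \<le> 1" "\<bar>w2\<bar> \<le> 1" "\<bar>w3\<bar> \<le> 1"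
      using koranyi_bounds[of w1 w2 w3 1] w by (auto simp: mem_hball_0 ww)
    have ba: "\<bar>a1\<bar> \<le> 1" "\<bar>a2\<bar> \<le> 1" "\<bar>a3\<bar> \<le> 1"
      using koranyi_bounds[of a1 a2 a3 1] a by (auto simp: mem_hball_0)
    define \<alpha> where "\<alpha> = g * a1 + w1"
    define \<beta> where "\<beta> = g * a2 + w2"
    define \<zeta> where "\<zeta> = g\<^sup>2 * a3 + w3 + g / 2 * (a1 * w2 - a2 * w1)"
    have ga: "\<bar>g * a1\<bar> \<le> g" "\<bar>g * a2\<bar> \<le> g" "\<bar>g\<^sup>2 * a3\<bar> \<le> g\<^sup>2"
      using ba g by (simp_all add: abs_mult mult_left_le)
    have "\<bar>a1 * w2\<bar> \<le> 1" "\<bar>a2 * w1\<bar> \<le> 1"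
      using ba bw by (simp_all add: abs_mult mult_le_one)
    then have "\<bar>a1 * w2 - a2 * w1\<bar> \<le> 2"
      by linarith
    then have "\<bar>g / 2 * (a1 * w2 - a2 * w1)\<bar> \<le> g"
      using g mult_left_mono[of "\<bar>a1 * w2 - a2 * w1\<bar>" 2 "g / 2"] by (simp add: abs_mult)
    then have "\<bar>\<zeta>\<bar> \<le> g\<^sup>2 + 1 + g"
      using ga bw unfolding \<zeta>_def by linarith
    then have b: "\<bar>\<alpha>\<bar> \<le> g + 1" "\<bar>\<beta>\<bar> \<le> g + 1" "\<bar>\<zeta>\<bar> \<le> (g + 1)\<^sup>2"
      using ga bw g unfolding \<alpha>_def \<beta>_def by (simp_all add: power2_sum)
    have "p *\<^sub>H hdil (g * e) (a1, a2, a3) *\<^sub>H hdil e w = p *\<^sub>H (e * \<alpha>, e * \<beta>, e\<^sup>2 * \<zeta>)"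
      unfolding ww hmul_assoc hmul_dilations \<alpha>_def \<beta>_def \<zeta>_def ..
    note eq = this[unfolded p_def, THEN arg_cong[of _ _ "quartic k"], unfolded quartic_expand, folded p_def]
    have "?P w = 1 - s * (e * (quartic_X k p * \<alpha> + quartic_Y k p * \<beta>) + e\<^sup>2 * (quartic_XX k p * (\<alpha>\<^sup>2 + \<beta>\<^sup>2) + 32 * z * \<zeta>))
        + s\<^sup>2 / 2 * (e\<^sup>2 * (quartic_X k p * \<alpha> + quartic_Y k p * \<beta>)\<^sup>2) - remainder g s * e ^ 3"
      unfolding cs L_def \<alpha>_def \<beta>_def \<zeta>_def ww fst_conv snd_conv by (simp add: field_simps power2_eq_square)
    also have "\<dots> \<le> exp (- s * (quartic k (p *\<^sub>H hdil (g * e) (a1, a2, a3) *\<^sub>H hdil e w) - quartic k p))"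
      unfolding eq add_diff_cancel_left' unfolding remainder_def p_def
      by (intro exp_perturbation_lower e s expansion_bounds[OF q k _ b]) (simp_all add: g)
    also have "\<dots> = ?F w / exp (- s * quartic k p)"
      by (simp add: exp_diff[symmetric] algebra_simps)
    finally show ?thesis
      by (simp add: field_simps)
  qed
  have "exp (- s * quartic k p) * (c0 + c11 * var1 + c22 * var2) = (\<integral>w. exp (- s * quartic k p) * ?P w \<partial>noise)"
    unfolding integral_mult_right_zero integral_noise_quadratic var1_def var2_def ..
  also have "\<dots> \<le> (\<integral>w. ?F w \<partial>noise)"
  proof (rule integral_mono)
    show "integrable noise (\<lambda>w. exp (- s * quartic k p) * ?P w)"
      by (intro integrable_mult_right integrable_noise_quadratic)
    have "continuous_on UNIV ?F"
      by (intro continuous_on_exp continuous_on_mult continuous_on_const continuous_on_quartic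
          continuous_on_hmul continuous_on_hdil continuous_on_id)
    then show "integrable noise ?F"
      using s quartic_nonneg by (intro integrable_noise[of _ 1] borel_measurable_continuous_onI) simp_all
  qed (use pw in simp)
  also have "c0 + c11 * var1 + c22 * var2 = (1 - s * (odd_part k g e p (a1, a2, a3) + even_part k g s e p (a1, a2, a3))
      + s * e\<^sup>2 * (s / 2 * ((quartic_X k p)\<^sup>2 * var1 + (quartic_Y k p)\<^sup>2 * var2) - quartic_XX k p * (var1 + var2))
      - remainder g s * e ^ 3)"
    unfolding cs odd_part_def even_part_def L_def p_def by (simp add: field_simps power2_eq_square)
  finally show ?thesis .
qed

section \<open>A strict supersolution at unit scale\<close>

text \<open>
  If the even part is positive, then \<open>b\<close> makes a definite angle with the horizontal gradient, which is then
  bounded below; moving along the gradient instead gains at first order in \<open>e\<close>.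
\<close>

lemma odd_even_le:
  fixes k s g e :: real
  assumes k: "0 < k" "k < 1" and s: "0 < s" "3 \<le> 2 * s * k\<^sup>2" and g: "0 \<le> g" and e: "0 < e" "e * g \<le> k\<^sup>2 / 1000"
    and q: "koranyi q < 3" "k\<^sup>2 \<le> quartic k q" and b: "b \<in> hball 0 1"
  shows "\<exists>b'\<in>hball 0 1. odd_part k g e q b + even_part k g s e q b \<le> odd_part k g e q b'"
proof (cases "even_part k g s e q b \<le> 0")
  case True
  then show ?thesis
    using b by (intro bexI[of _ b]) auto
next
  case False
  obtain x y z where qq: "q = (x, y, z)" by (cases q)
  obtain b1 b2 b3 where bb: "b = (b1, b2, b3)" by (cases b)
  define R where "R = x\<^sup>2 + y\<^sup>2"
  define u where "u = quartic_X k q"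
  define v where "v = quartic_Y k q"
  define L where "L = u * b1 + v * b2"
  define N where "N = sqrt (u\<^sup>2 + v\<^sup>2)"
  have R: "R \<le> 9" "0 \<le> R" and z: "\<bar>z\<bar> \<le> 3"
    using koranyi_bounds[of x y z 3] q by (auto simp: qq R_def)
  have b12: "b1\<^sup>2 + b2\<^sup>2 \<le> 1" and b3: "4 * \<bar>b3\<bar> \<le> 1"
    using koranyi_bounds[of b1 b2 b3 1] b by (auto simp: bb mem_hball_0)
  have even: "even_part k g s e q b = (e * g)\<^sup>2 * ((6 * R - 2 * k) * (b1\<^sup>2 + b2\<^sup>2) - s / 2 * L\<^sup>2)"
    by (simp add: even_part_def bb quartic_XX_def qq R_def L_def u_def v_def power_mult_distrib)
  with False have "0 < (e * g)\<^sup>2 * ((6 * R - 2 * k) * (b1\<^sup>2 + b2\<^sup>2) - s / 2 * L\<^sup>2)"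
    by simp
  then have eg: "0 < (e * g)\<^sup>2" and pos: "s / 2 * L\<^sup>2 < (6 * R - 2 * k) * (b1\<^sup>2 + b2\<^sup>2)"
    by (auto simp: zero_less_mult_iff simp del: zero_less_power2)
  have "0 \<le> s / 2 * L\<^sup>2"
    using s by simp
  then have "0 < (6 * R - 2 * k) * (b1\<^sup>2 + b2\<^sup>2)"
    using pos by linarith
  moreover have "0 \<le> b1\<^sup>2 + b2\<^sup>2"
    by simp
  \<comment> \<open>A positive even part forces a positive Hessian coefficient, which keeps the
    point away from the axis.\<close>
  ultimately have Rk: "k < 3 * R"
    unfolding zero_less_mult_iff by linarith
  then have "(6 * R - 2 * k) * (b1\<^sup>2 + b2\<^sup>2) \<le> 6 * R - 2 * k"
    using b12 by (intro mult_left_le) auto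
  then have sL: "s * L\<^sup>2 < 12 * R"
    using pos k by linarith
  have N2: "N\<^sup>2 = 16 * R * quartic k q"
    unfolding N_def u_def v_def qq R_def quartic_grad[symmetric] by simp
  have Rk2: "R * k\<^sup>2 \<le> R * quartic k q"
    using q R by (intro mult_left_mono)
  have "s * L\<^sup>2 < s * (8 * R * k\<^sup>2)"
    using sL mult_left_mono[OF s(2) R(2)] by (simp add: algebra_simps)
  then have "L\<^sup>2 < 8 * R * k\<^sup>2"
    using s by simp
  \<comment> \<open>The squared gradient is at least \<open>16 R k^2\<close>, so \<open>L^2\<close>
    is at most half of it, and 1/2 < 25/49. This is the definite angle.\<close>
  then have "L\<^sup>2 \<le> (5 / 7 * N)\<^sup>2"
    using Rk2 N2 zero_le_power2[of N] unfolding power_mult_distrib mult.assoc by (simp add: power_divide)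
  then have L: "L \<le> 5 / 7 * N"
    by (rule power2_le_imp_le) (simp add: N_def)
  have "(4 / 3 * k\<^sup>2)\<^sup>2 \<le> N\<^sup>2"
  proof -
    have "k\<^sup>2 * k\<^sup>2 \<le> k * k\<^sup>2"
      using k by (intro mult_right_mono) (auto simp: power2_eq_square mult_le_cancel_left1)
    also have "\<dots> \<le> (3 * R) * k\<^sup>2"
      using Rk by (intro mult_right_mono) auto
    finally have "k\<^sup>2 * k\<^sup>2 \<le> 3 * (R * k\<^sup>2)"
      by simp
    moreover have "(4 / 3 * k\<^sup>2)\<^sup>2 = 16 / 9 * (k\<^sup>2 * k\<^sup>2)"
      by (simp add: power2_eq_square)
    moreover have "0 \<le> R * k\<^sup>2"
      using R by simp
    ultimately show ?thesis
      using N2[unfolded mult.assoc] Rk2 by linarith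
  qed
  then have N: "4 / 3 * k\<^sup>2 \<le> N"
    by (rule power2_le_imp_le) (simp add: N_def)
  moreover have "0 < 4 / 3 * k\<^sup>2"
    using k by simp
  ultimately have N0: "0 < N"
    by linarith
  have uv: "u\<^sup>2 + v\<^sup>2 = N\<^sup>2"
    by (simp add: N_def)
  \<comment> \<open>Nine tenths of the unit gradient direction, because the ball of moves is open;
    9/10 still exceeds 5/7 by 13/70.\<close>
  let ?b = "(9 / 10 * u / N, 9 / 10 * v / N, 0)"
  have "(9 / 10 * u / N)\<^sup>2 + (9 / 10 * v / N)\<^sup>2 = 81 / 100 * ((u\<^sup>2 + v\<^sup>2) / N\<^sup>2)"
    using N0 by (simp add: power_divide power_mult_distrib field_simps)
  also have "\<dots> = 81 / 100"
    using N0 by (simp add: uv)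
  finally have bn: "(9 / 10 * u / N)\<^sup>2 + (9 / 10 * v / N)\<^sup>2 = 81 / 100" .
  have ball: "?b \<in> hball 0 1"
    unfolding hball_0_pow4 bn by (simp add: power2_eq_square)
  have "u * (9 / 10 * u / N) + v * (9 / 10 * v / N) = 9 / 10 * ((u\<^sup>2 + v\<^sup>2) / N)"
    using N0 by (simp add: power2_eq_square field_simps)
  also have "\<dots> = 9 / 10 * N"
    unfolding uv using N0 by (simp add: power2_eq_square)
  finally have ob: "odd_part k g e q ?b = (e * g) * (9 / 10 * N)"
    by (simp add: odd_part_def u_def v_def)
  have "\<bar>z * b3\<bar> \<le> 3 * (1 / 4)"
    unfolding abs_mult using z b3 by (intro mult_mono) auto
  then have zb: "z * b3 \<le> 3 / 4"
    by simp
  have "(6 * R - 2 * k) * (b1\<^sup>2 + b2\<^sup>2) - s / 2 * L\<^sup>2 \<le> 6 * R - 2 * k"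
    using \<open>(6 * R - 2 * k) * (b1\<^sup>2 + b2\<^sup>2) \<le> 6 * R - 2 * k\<close> \<open>0 \<le> s / 2 * L\<^sup>2\<close> by linarith
  then have E: "(6 * R - 2 * k) * (b1\<^sup>2 + b2\<^sup>2) - s / 2 * L\<^sup>2 \<le> 54"
    using R k by linarith
  have "odd_part k g e q b + even_part k g s e q b
      = (e * g) * L + (e * g)\<^sup>2 * (32 * (z * b3) + ((6 * R - 2 * k) * (b1\<^sup>2 + b2\<^sup>2) - s / 2 * L\<^sup>2))"
    unfolding even by (simp add: odd_part_def bb qq L_def u_def v_def power2_eq_square algebra_simps)
  \<comment> \<open>Here 78 = 32 * 3/4 + 54, the vertical and the even contribution. The bound on
    \<open>e * g\<close> makes \<open>78 * e * g\<close> smaller than the gap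
    \<open>13 / 70 * N\<close>.\<close>
  also have "\<dots> \<le> (e * g) * (5 / 7 * N) + (e * g)\<^sup>2 * 78"
    using L zb E e g by (intro add_mono mult_left_mono) auto
  also have "\<dots> = (e * g) * (5 / 7 * N + (e * g) * 78)"
    by (simp add: power2_eq_square algebra_simps)
  also have "\<dots> \<le> (e * g) * (9 / 10 * N)"
  proof (rule mult_left_mono)
    show "5 / 7 * N + e * g * 78 \<le> 9 / 10 * N"
      using N e(2) zero_le_power2[of k] by linarith
  qed (use e g in simp)
  finally show ?thesis
    using ob ball by (intro bexI[of _ ?b]) auto
qed

lemma uminus_hball_0: "b \<in> hball 0 1 \<Longrightarrow> - b \<in> hball 0 1"
  by (cases b) (simp add: hball_0_pow4)

text \<open>Take the first member of a countable dense set of moves that answers every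
  \<open>b\<close> up to \<open>t\<close>. One exists because the ball of moves is symmetric, so the
  negative of a near maximiser nearly minimises.\<close>

lemma measurable_near_minimizer:
  fixes v :: "heis \<Rightarrow> heis"
  assumes v: "continuous_on UNIV v" and t: "0 < t"
  obtains S where "S \<in> borel_measurable borel" "\<And>q. S q \<in> hball 0 1"
    "\<And>q b. b \<in> hball 0 1 \<Longrightarrow> S q \<bullet> v q + b \<bullet> v q \<le> t"
proof -
  obtain C where C: "countable C" "C \<subseteq> hball 0 1" "hball 0 1 \<subseteq> closure C"
    using separable[of "hball 0 1"] by metis
  then have "C \<noteq> {}"
    using zero_mem_hball_0 by auto
  define c where "c = from_nat_into C"
  have c: "c n \<in> hball 0 1" for n
    using from_nat_into[OF \<open>C \<noteq> {}\<close>] C c_def by auto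
  define P where "P n q \<longleftrightarrow> (\<forall>b\<in>hball 0 1. c n \<bullet> v q + b \<bullet> v q \<le> t)" for n q
  have ex: "\<exists>n. P n q" for q
  proof -
    let ?s = "SUP b\<in>hball 0 1. b \<bullet> v q"
    have "b \<bullet> v q \<le> 2 * norm (v q)" if "b \<in> hball 0 1" for b
    proof -
      obtain x y z where b: "b = (x, y, z)" by (cases b)
      have k: "koranyi (x, y, z) < 1"
        using that by (simp add: b mem_hball_0)
      have "z\<^sup>2 \<le> 1"
        using koranyi_bounds(4)[OF k] by (simp add: abs_square_le_1)
      then have "norm b \<le> 2"
        using koranyi_bounds(1)[OF k] by (simp add: b norm_Pair real_le_lsqrt)
      then show ?thesis
        by (rule order_trans[OF norm_cauchy_schwarz mult_right_mono]) simp
    qed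
    then have bdd: "bdd_above ((\<lambda>b. b \<bullet> v q) ` hball 0 1)"
      by (intro bdd_aboveI2[where M="2 * norm (v q)"])
    have "?s - t / 2 < ?s"
      using t by simp
    then obtain b0 where b0: "b0 \<in> hball 0 1" "?s - t / 2 < b0 \<bullet> v q"
      using zero_mem_hball_0 less_cSUP_iff[OF _ bdd] by blast
    \<comment> \<open>An open condition satisfied by \<open>- b0\<close>, which lies in the closure
      of \<open>C\<close>, is also satisfied by a point of \<open>C\<close>.\<close>
    let ?A = "{a. a \<bullet> v q < - (b0 \<bullet> v q) + t / 2}"
    have "open ?A"
      by (intro open_Collect_less continuous_on_inner continuous_on_id continuous_on_const)
    moreover have "- b0 \<in> ?A \<inter> closure C"
      using subsetD[OF C(3) uminus_hball_0[OF b0(1)]] t by simp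
    ultimately have "?A \<inter> C \<noteq> {}"
      using open_Int_closure_eq_empty[of ?A C] by blast
    then obtain a where a: "a \<in> C" "a \<bullet> v q < - (b0 \<bullet> v q) + t / 2"
      by auto
    then obtain n where n: "a = c n"
      unfolding c_def using C by (metis from_nat_into_surj)
    have "P n q"
      unfolding P_def
    proof
      fix b assume "b \<in> hball 0 1"
      then have "b \<bullet> v q \<le> ?s"
        by (rule cSUP_upper[OF _ bdd])
      then show "c n \<bullet> v q + b \<bullet> v q \<le> t"
        using a(2) b0(2) unfolding n by linarith
    qed
    then show ?thesis ..
  qed
  define S where "S q = c (LEAST n. P n q)" for q
  \<comment> \<open>Closedness in \<open>q\<close> survives the intersection over uncountably many
    \<open>b\<close>; this is how continuity of \<open>v\<close> yields measurability of the least
    index.\<close>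
  have "closed {q. P n q}" for n
  proof -
    have "{q. P n q} = (\<Inter>b\<in>hball 0 1. {q. c n \<bullet> v q + b \<bullet> v q \<le> t})"
      unfolding P_def by auto
    also have "closed \<dots>"
      by (intro closed_INT ballI closed_Collect_le continuous_on_add continuous_on_inner continuous_on_const v)
    finally show ?thesis .
  qed
  then have [measurable]: "Measurable.pred borel (P n)" for n
    by (simp add: pred_def)
  have "(\<lambda>q. LEAST n. P n q) \<in> measurable borel (count_space UNIV)"
    by measurable
  then have S: "S \<in> borel_measurable borel"
    unfolding S_def by (rule measurable_compose) simp
  have "P (LEAST n. P n q) q" for q
    using ex[of q] by (rule LeastI_ex)
  then show thesis
    using that[of S] S c unfolding S_def P_def by blast
qed

text \<open>The turn in which neither player moves is the case \<open>a = 0\<close>.\<close>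

definition move_mean :: "real \<Rightarrow> real \<Rightarrow> (heis \<Rightarrow> real) \<Rightarrow> heis \<Rightarrow> heis \<Rightarrow> real" where
  "move_mean g e f q a = (\<integral>w. f (q *\<^sub>H hdil (g * e) a *\<^sub>H hdil e w) \<partial>noise)"

text \<open>By \<open>quartic_grad\<close> the gradient term is at least a multiple of
  \<open>16 R k^2\<close>, and \<open>s\<close> is large enough for it to absorb the
  \<open>6 R\<close> in \<open>quartic_XX\<close>. What survives comes from the shift by
  \<open>k\<close> and does not degenerate on the axis.\<close>

lemma noise_term_lower:
  fixes k s :: real
  assumes k: "0 < k" and m: "0 < m" "m \<le> var1" "m \<le> var2" and s: "0 < s" "var1 + var2 \<le> s * m * k\<^sup>2"
    and q: "k\<^sup>2 \<le> quartic k q"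
  shows "2 * k * (var1 + var2) \<le> s / 2 * ((quartic_X k q)\<^sup>2 * var1 + (quartic_Y k q)\<^sup>2 * var2) - quartic_XX k q * (var1 + var2)"
proof -
  obtain x y z where qq: "q = (x, y, z)" by (cases q)
  define R where "R = x\<^sup>2 + y\<^sup>2"
  have R: "0 \<le> R"
    by (simp add: R_def)
  have "(var1 + var2) * (6 * R) \<le> (var1 + var2) * (8 * R)"
    using m R by (intro mult_left_mono) auto
  also have "\<dots> \<le> s * m * k\<^sup>2 * (8 * R)"
    using s R by (intro mult_right_mono) auto
  also have "\<dots> = s / 2 * m * (16 * R * k\<^sup>2)"
    by simp
  also have "\<dots> \<le> s / 2 * m * (16 * R * quartic k q)"
    using q R s m by (intro mult_left_mono) auto
  also have "16 * R * quartic k q = (quartic_X k q)\<^sup>2 + (quartic_Y k q)\<^sup>2"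
    unfolding qq R_def quartic_grad ..
  also have "s / 2 * m * \<dots> = s / 2 * ((quartic_X k q)\<^sup>2 * m + (quartic_Y k q)\<^sup>2 * m)"
    by (simp add: algebra_simps)
  also have "\<dots> \<le> s / 2 * ((quartic_X k q)\<^sup>2 * var1 + (quartic_Y k q)\<^sup>2 * var2)"
    using s m by (intro mult_left_mono add_mono) auto
  finally show ?thesis
    by (simp add: quartic_XX_def qq R_def algebra_simps)
qed

text \<open>
  Player I nearly minimises the odd part, which nearly cancels its maximum over the moves of player II.
  By \<open>odd_even_le\<close> the even parts of both moves are absorbed, and the noise contributes the strict gain.
\<close>

lemma exp_quartic_supersolution:
  fixes k g :: real
  assumes k: "0 < k" "k < 1" and g: "0 \<le> g"
  obtains s e0 where "0 < s" "0 < e0"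
    "\<And>e. 0 < e \<Longrightarrow> e < e0 \<Longrightarrow> \<exists>S c. S \<in> borel_measurable borel \<and> (\<forall>q. S q \<in> hball 0 1) \<and> 0 < c \<and>
      (\<forall>q b. koranyi q < 3 \<longrightarrow> k\<^sup>2 \<le> quartic k q \<longrightarrow> b \<in> hball 0 1 \<longrightarrow>
        3 * (exp (- s * quartic k q) * (1 + c)) \<le> move_mean g e (\<lambda>q. exp (- s * quartic k q)) q (S q)
          + move_mean g e (\<lambda>q. exp (- s * quartic k q)) q b + move_mean g e (\<lambda>q. exp (- s * quartic k q)) q 0)"
proof -
  define m where "m = min var1 var2"
  have m: "0 < m" "m \<le> var1" "m \<le> var2"
    using noise_variance_pos by (auto simp: m_def var1_def var2_def)
  define V where "V = var1 + var2"
  have V: "0 < V"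
    using m by (simp add: V_def)
  \<comment> \<open>The first summand provides the bound required by \<open>odd_even_le\<close>, the
    second the one required by \<open>noise_term_lower\<close>.\<close>
  define s where "s = 3 / (2 * k\<^sup>2) + V / (m * k\<^sup>2)"
  have k2: "0 < k\<^sup>2"
    using k by simp
  have s1: "s * (2 * k\<^sup>2) = 3 + 2 * V / m" and s2: "s * (m * k\<^sup>2) = 3 * m / 2 + V"
    using k2 m unfolding s_def by (simp_all add: field_simps)
  have s: "0 < s" "3 \<le> 2 * s * k\<^sup>2" "V \<le> s * m * k\<^sup>2"
  proof -
    show "0 < s"
      unfolding s_def using k2 m V by (intro add_pos_pos divide_pos_pos mult_pos_pos) auto
    have "0 < 2 * V / m"
      using V m by simp
    then show "3 \<le> 2 * s * k\<^sup>2"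
      using s1 unfolding mult.assoc mult.left_commute[of s 2] by linarith
    show "V \<le> s * m * k\<^sup>2"
      using s2 m unfolding mult.assoc by linarith
  qed
  define C where "C = remainder g s"
  have C: "0 \<le> C"
    using s g by (simp add: C_def remainder_def)
  \<comment> \<open>The second bound serves \<open>odd_even_le\<close>. The third limits the errors
    \<open>2 s e^3\<close> and \<open>3 C e^3\<close> to half of the total noise gain
    \<open>6 s k V e^2\<close>.\<close>
  define e0 where "e0 = min 1 (min (k\<^sup>2 / (1000 * (g + 1))) (3 * s * k * V / (2 * s + 3 * C)))"
  have e0: "0 < e0"
    unfolding e0_def using k V s C g k2 by (simp add: add_pos_nonneg)
  show thesis
  proof (rule that[OF s(1) e0])
    fix e assume e: "0 < e" "e < e0"
    have e1: "e \<le> 1" and eg1: "e \<le> k\<^sup>2 / (1000 * (g + 1))" and eC: "e \<le> 3 * s * k * V / (2 * s + 3 * C)"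
      using e by (simp_all add: e0_def)
    have "e * (1000 * (g + 1)) \<le> k\<^sup>2"
      using eg1 g by (simp add: pos_le_divide_eq)
    then have eg: "e * g \<le> k\<^sup>2 / 1000"
      using e by (simp add: algebra_simps)
    have eC: "(2 * s + 3 * C) * e \<le> 3 * s * k * V"
      using eC s C by (simp add: pos_le_divide_eq add_pos_nonneg mult.commute)
    define v where "v q = (e * g * quartic_X k q, e * g * quartic_Y k q, 32 * e\<^sup>2 * g\<^sup>2 * snd (snd q))" for q
    have "continuous_on UNIV v"
      unfolding v_def quartic_X_def quartic_Y_def case_prod_beta by (intro continuous_intros)
    \<comment> \<open>The tolerance has the order of the Taylor remainder, one order below the
      gain.\<close>
    moreover have "0 < e ^ 3"
      using e by simp
    ultimately obtain S where S: "S \<in> borel_measurable borel" "\<And>q. S q \<in> hball 0 1"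
      "\<And>q b. b \<in> hball 0 1 \<Longrightarrow> S q \<bullet> v q + b \<bullet> v q \<le> e ^ 3"
      using measurable_near_minimizer by blast
    have odd: "odd_part k g e q a = a \<bullet> v q" for q a
      by (cases a) (simp add: odd_part_def v_def algebra_simps)
    let ?f = "\<lambda>q. exp (- s * quartic k q)"
    have "3 * (?f q * (1 + s * k * V * e\<^sup>2)) \<le> move_mean g e ?f q (S q) + move_mean g e ?f q b + move_mean g e ?f q 0"
      if q: "koranyi q < 3" "k\<^sup>2 \<le> quartic k q" and b: "b \<in> hball 0 1" for q b
    proof -
      let ?OE = "\<lambda>a. odd_part k g e q a + even_part k g s e q a"
      obtain x y z where qq: "q = (x, y, z)" by (cases q)
      have xyz: "\<bar>x\<bar> \<le> 3" "\<bar>y\<bar> \<le> 3" "\<bar>z\<bar> \<le> 3"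
        using koranyi_bounds[of x y z 3] q by (auto simp: qq)
      define T where "T = s / 2 * ((quartic_X k q)\<^sup>2 * var1 + (quartic_Y k q)\<^sup>2 * var2) - quartic_XX k q * (var1 + var2)"
      have T: "2 * k * V \<le> T"
        unfolding T_def V_def using s by (intro noise_term_lower[OF k(1) m _ _ q(2)]) (auto simp: V_def)
      have mm: "?f q * (1 - s * ?OE a + s * e\<^sup>2 * T - C * e ^ 3) \<le> move_mean g e ?f q a"
        if "a \<in> hball 0 1" for a
        using move_lower[OF xyz _ _ _ g, of k "fst a" "fst (snd a)" "snd (snd a)" s e] that k s e e1
        unfolding qq T_def C_def move_mean_def by simp
      note mm = mm[OF S(2)[of q]] mm[OF b] mm[OF zero_mem_hball_0]
      have OE0: "?OE 0 = 0"
        by (simp add: odd_part_def even_part_def zero_prod_def)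
      have oe: "odd_part k g e q (S q) + ?OE a \<le> e ^ 3" if a: "a \<in> hball 0 1" for a
      proof -
        obtain b' where "b' \<in> hball 0 1" "?OE a \<le> odd_part k g e q b'"
          using odd_even_le[OF k s(1,2) g e(1) eg q a] by blast
        then show ?thesis
          using S(3)[of b' q] unfolding odd by linarith
      qed
      have "even_part k g s e q (- a) = even_part k g s e q a" for a
        by (cases a) (simp add: even_part_def power2_eq_square algebra_simps)
      \<comment> \<open>Besides \<open>b\<close>, the opposing move \<open>- S q\<close> is tested:
        the odd parts cancel, so the even part of player I's own move is at most
        \<open>e^3\<close>.\<close>
      then have "?OE (S q) + ?OE b \<le> 2 * e ^ 3"
        using oe[OF b] oe[OF uminus_hball_0[OF S(2)[of q]]] unfolding odd by simp
      then have "s * (?OE (S q) + ?OE b) \<le> s * (2 * e ^ 3)"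
        using s by (intro mult_left_mono) auto
      moreover have "s * e\<^sup>2 * (2 * k * V) \<le> s * e\<^sup>2 * T"
        using T s by (intro mult_left_mono) auto
      moreover have "(2 * s + 3 * C) * e * e\<^sup>2 \<le> 3 * s * k * V * e\<^sup>2"
        using eC by (intro mult_right_mono) auto
      ultimately have "3 * (1 + s * k * V * e\<^sup>2) \<le> (1 - s * ?OE (S q) + s * e\<^sup>2 * T - C * e ^ 3)
          + (1 - s * ?OE b + s * e\<^sup>2 * T - C * e ^ 3) + (1 - s * ?OE 0 + s * e\<^sup>2 * T - C * e ^ 3)"
        unfolding OE0 by (simp add: algebra_simps power2_eq_square power3_eq_cube)
      then have "?f q * (3 * (1 + s * k * V * e\<^sup>2)) \<le> ?f q * ((1 - s * ?OE (S q) + s * e\<^sup>2 * T - C * e ^ 3)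
          + (1 - s * ?OE b + s * e\<^sup>2 * T - C * e ^ 3) + (1 - s * ?OE 0 + s * e\<^sup>2 * T - C * e ^ 3))"
        by (intro mult_left_mono) auto
      moreover have "3 * (F * c) \<le> p + r + t" if "F * (3 * c) \<le> F * (A + B + D)" "F * A \<le> p" "F * B \<le> r" "F * D \<le> t"
        for F c A B D p r t :: real
        using that by (simp add: distrib_left mult.left_commute)
      ultimately show ?thesis
        using mm by blast
    qed
    moreover have "0 < s * k * V * e\<^sup>2"
      using s k V e by simp
    ultimately show "\<exists>S c. S \<in> borel_measurable borel \<and> (\<forall>q. S q \<in> hball 0 1) \<and> 0 < c \<and>
      (\<forall>q b. koranyi q < 3 \<longrightarrow> k\<^sup>2 \<le> quartic k q \<longrightarrow> b \<in> hball 0 1 \<longrightarrow>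
        3 * (?f q * (1 + c)) \<le> move_mean g e ?f q (S q) + move_mean g e ?f q b + move_mean g e ?f q 0)"
      using S by blast
  qed
qed

section \<open>Barriers\<close>

lemma quartic_koranyi: "quartic k (x, y, z) = koranyi (x, y, z) ^ 4 - 2 * k * (x\<^sup>2 + y\<^sup>2) + k\<^sup>2"
  unfolding koranyi_pow4 by (simp add: quartic_def power2_diff)

lemma horizontal_le_koranyi: "x\<^sup>2 + y\<^sup>2 \<le> (koranyi (x, y, z))\<^sup>2"
  unfolding koranyi_sq using complex_Re_le_cmod[of "Complex (x\<^sup>2 + y\<^sup>2) (4 * z)"] by simp

text \<open>17 = 2^4 + 1. The later lemma \<open>koranyi_less_3\<close> supplies the companion level
  18, and the gap between the two levels produces the contraction in
  \<open>barrier_refine\<close>.\<close>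

lemma quartic_le_17:
  assumes "0 \<le> k" "k \<le> 1" "koranyi q < 2"
  shows "quartic k q \<le> 17"
proof (cases q)
  fix x y z assume q: "q = (x, y, z)"
  have "koranyi q ^ 4 \<le> 2 ^ 4"
    using assms koranyi_nonneg by (intro power_mono) auto
  moreover have "0 \<le> 2 * k * (x\<^sup>2 + y\<^sup>2)" "k\<^sup>2 \<le> 1"
    using assms by (auto simp: power_le_one)
  ultimately show ?thesis
    unfolding q quartic_koranyi by simp
qed

lemma quartic_ge:
  assumes "0 \<le> k"
  shows "((koranyi q)\<^sup>2 - k)\<^sup>2 \<le> quartic k q"
proof (cases q)
  fix x y z assume q: "q = (x, y, z)"
  have "2 * k * (x\<^sup>2 + y\<^sup>2) \<le> 2 * k * (koranyi q)\<^sup>2"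
    unfolding q using assms by (intro mult_left_mono horizontal_le_koranyi) auto
  moreover have "koranyi q ^ 4 = ((koranyi q)\<^sup>2)\<^sup>2"
    by simp
  ultimately show ?thesis
    unfolding q quartic_koranyi power2_diff by (simp add: mult_ac)
qed

lemma koranyi_less_3:
  assumes "0 \<le> k" "k \<le> 1" "quartic k q < 18"
  shows "koranyi q < 3"
proof (rule ccontr)
  assume "\<not> ?thesis"
  then have "3\<^sup>2 \<le> (koranyi q)\<^sup>2"
    by (intro power_mono) auto
  then have "8\<^sup>2 \<le> ((koranyi q)\<^sup>2 - k)\<^sup>2"
    using assms by (intro power_mono) auto
  then show False
    using quartic_ge[of k q] assms by simp
qed

text \<open>The origin of \<open>k = m^2 / 2\<close>: outside the ball of radius \<open>m\<close>
  the squared gauge exceeds \<open>k\<close> by at least \<open>k\<close>.\<close>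

lemma quartic_ge_sq:
  assumes "0 \<le> m" "m \<le> koranyi q"
  shows "(m\<^sup>2 / 2)\<^sup>2 \<le> quartic (m\<^sup>2 / 2) q"
proof -
  have "m\<^sup>2 \<le> (koranyi q)\<^sup>2"
    using assms by (intro power_mono) auto
  then have "(m\<^sup>2 / 2)\<^sup>2 \<le> ((koranyi q)\<^sup>2 - m\<^sup>2 / 2)\<^sup>2"
    by (intro power_mono) auto
  with quartic_ge[of "m\<^sup>2 / 2" q] show ?thesis
    by simp
qed

lemma integrable_move:
  fixes f :: "heis \<Rightarrow> real"
  assumes "f \<in> borel_measurable borel" "\<And>q. \<bar>f q\<bar> \<le> B"
  shows "integrable noise (\<lambda>w. f (q *\<^sub>H hdil l a *\<^sub>H hdil e w))"
proof (rule integrable_noise)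
  have "(\<lambda>w. q *\<^sub>H hdil l a *\<^sub>H hdil e w) \<in> borel_measurable borel"
    by (intro borel_measurable_continuous_onI continuous_on_hmul continuous_on_hdil continuous_on_const continuous_on_id)
  then show "(\<lambda>w. f (q *\<^sub>H hdil l a *\<^sub>H hdil e w)) \<in> borel_measurable borel"
    using assms(1) by (rule measurable_compose)
qed (rule assms)

lemma move_mean_mono:
  assumes "f \<in> borel_measurable borel" "\<And>q. \<bar>f q\<bar> \<le> B" "h \<in> borel_measurable borel" "\<And>q. \<bar>h q\<bar> \<le> B'"
    and "\<And>w. w \<in> hball 0 1 \<Longrightarrow> f (q *\<^sub>H hdil (g * e) a *\<^sub>H hdil e w) \<le> h (q *\<^sub>H hdil (g * e) a *\<^sub>H hdil e w)"
  shows "move_mean g e f q a \<le> move_mean g e h q a"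
  unfolding move_mean_def
proof (rule integral_mono)
  show "integrable noise (\<lambda>w. f (q *\<^sub>H hdil (g * e) a *\<^sub>H hdil e w))"
    using assms(1,2) by (rule integrable_move)
  show "integrable noise (\<lambda>w. h (q *\<^sub>H hdil (g * e) a *\<^sub>H hdil e w))"
    using assms(3,4) by (rule integrable_move)
qed (use assms(5) in simp)

lemma hdist_move:
  assumes "0 \<le> g" "0 < e" "a \<in> hball 0 1" "w \<in> hball 0 1"
  shows "hdist q (q *\<^sub>H hdil (g * e) a *\<^sub>H hdil e w) \<le> (g + 1) * e"
proof -
  have "hdist q (q *\<^sub>H hdil (g * e) a *\<^sub>H hdil e w) \<le> g * e * koranyi a + e * koranyi w"
    using koranyi_triangle[of "hdil (g * e) a" "hdil e w"] assms
    by (simp add: hdist_def hmul_assoc koranyi_hdil)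
  also have "\<dots> \<le> g * e * 1 + e * 1"
    using assms by (intro add_mono mult_left_mono) (auto simp: mem_hball_0)
  finally show ?thesis
    by (simp add: algebra_simps)
qed

text \<open>Moves are right multiplications, so they commute with the left translation by
  \<open>hinv p\<close>, and the dilation merely changes the step from \<open>e\<close> to
  \<open>e / r\<close>.\<close>

lemma move_mean_rescale:
  assumes "0 < r"
  shows "move_mean g e (\<lambda>q. f (hdil (1 / r) (hinv p *\<^sub>H q))) q a = move_mean g (e / r) f (hdil (1 / r) (hinv p *\<^sub>H q)) a"
  unfolding move_mean_def by (simp add: hmul_assoc[symmetric] hdil_hmul hdil_hdil)

text \<open>The inequality is demanded only where the game is undecided: outside \<open>D\<close> it
  stops at the next turn, and reaching \<open>U q = 1\<close> is counted as a loss.\<close>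

definition strict_step :: "heis set \<Rightarrow> real \<Rightarrow> real \<Rightarrow> (heis \<Rightarrow> real) \<Rightarrow> (heis \<Rightarrow> heis) \<Rightarrow> real \<Rightarrow> bool" where
  "strict_step D g e U S c \<longleftrightarrow> S \<in> borel_measurable borel \<and> (\<forall>q. S q \<in> hball 0 1) \<and> 0 < c \<and>
     (\<forall>q\<in>D. U q < 1 \<longrightarrow> (\<forall>b\<in>hball 0 1.
       move_mean g e U q (S q) + move_mean g e U q b + move_mean g e U q 0 \<le> 3 * (U q - c)))"

text \<open>\<open>U\<close> is chosen before the step size, so that \<open>h\<close> bounds the
  failure probability for all small steps; \<open>S\<close> and \<open>c\<close> may depend on the
  step, since \<open>c\<close> only has to make the game end.\<close>

definition barrier :: "heis set \<Rightarrow> real \<Rightarrow> heis \<Rightarrow> real \<Rightarrow> real \<Rightarrow> (heis \<Rightarrow> real) \<Rightarrow> real \<Rightarrow> bool" where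
  "barrier D g q0 \<delta> h U r \<longleftrightarrow> U \<in> borel_measurable borel \<and> (\<forall>q. 0 \<le> U q \<and> U q \<le> 1) \<and>
     (\<forall>q. U q < 1 \<longrightarrow> q \<in> hball q0 \<delta>) \<and> 0 < r \<and> r \<le> \<delta> \<and> (\<forall>q\<in>hball q0 r. U q \<le> h) \<and>
     (\<exists>e0>0. \<forall>e. 0 < e \<longrightarrow> e < e0 \<longrightarrow> (\<exists>S c. strict_step D g e U S c))"

text \<open>
  The new barrier is the minimum of the old one and a rescaled copy of \<open>1 - exp (- s * quartic k)\<close> around the
  exterior ball, normalised so that the old one is smaller where \<open>quartic k \<ge> 18\<close>. At each point player I follows
  the strategy belonging to the smaller function.
\<close>

lemma barrier_refine:
  assumes cork: "\<mu> \<in> {0<..<1}" "\<forall>\<^sub>F r in at_right 0. \<exists>p0. hball p0 (\<mu> * r) \<subseteq> hball q0 r - D"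
    and g: "0 \<le> g" and s: "0 < s" and e1: "0 < e1"
    and sup: "\<And>e. 0 < e \<Longrightarrow> e < e1 \<Longrightarrow> \<exists>S c. S \<in> borel_measurable borel \<and> (\<forall>q. S q \<in> hball 0 1) \<and> 0 < c \<and>
      (\<forall>q b. koranyi q < 3 \<longrightarrow> (\<mu>\<^sup>2 / 2)\<^sup>2 \<le> quartic (\<mu>\<^sup>2 / 2) q \<longrightarrow> b \<in> hball 0 1 \<longrightarrow>
        3 * (exp (- s * quartic (\<mu>\<^sup>2 / 2) q) * (1 + c)) \<le> move_mean g e (\<lambda>q. exp (- s * quartic (\<mu>\<^sup>2 / 2) q)) q (S q)
          + move_mean g e (\<lambda>q. exp (- s * quartic (\<mu>\<^sup>2 / 2) q)) q b + move_mean g e (\<lambda>q. exp (- s * quartic (\<mu>\<^sup>2 / 2) q)) q 0)"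
    and bar: "barrier D g q0 \<delta> h U r" and h: "0 < h"
  shows "\<exists>U' r'. barrier D g q0 \<delta> (h * ((1 - exp (- s * 17)) / (1 - exp (- s * 18)))) U' r'"
proof -
  define k where "k = \<mu>\<^sup>2 / 2"
  have k: "0 \<le> k" "k \<le> 1"
    using cork(1) by (auto simp: k_def power2_eq_square intro: order_trans[OF mult_le_one])
  have U: "U \<in> borel_measurable borel" "\<And>q. 0 \<le> U q" "\<And>q. U q \<le> 1" "\<And>q. U q < 1 \<Longrightarrow> q \<in> hball q0 \<delta>"
    and r: "0 < r" "r \<le> \<delta>" and Ur: "\<And>q. q \<in> hball q0 r \<Longrightarrow> U q \<le> h"
    using bar by (auto simp: barrier_def)
  obtain e0 where e0: "0 < e0" "\<And>e. 0 < e \<Longrightarrow> e < e0 \<Longrightarrow> \<exists>S c. strict_step D g e U S c"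
    using bar by (auto simp: barrier_def)
  obtain b where b: "0 < b" "\<And>r. 0 < r \<Longrightarrow> r < b \<Longrightarrow> \<exists>p0. hball p0 (\<mu> * r) \<subseteq> hball q0 r - D"
    using cork(2) unfolding eventually_at_right_field by blast
  \<comment> \<open>With \<open>p\<close> within \<open>R\<close> of \<open>q0\<close>, the set
    where the new function is below \<open>h\<close> lies within \<open>3 R\<close> of
    \<open>p\<close>, hence within \<open>4 R\<close> of \<open>q0\<close>. One step of length below
    \<open>R\<close> then stays inside \<open>5 R\<close>, where the old barrier is at most
    \<open>h\<close>.\<close>
  define R where "R = min (r / 5) (b / 2)"
  have R: "0 < R" "5 * R \<le> r" "R < b"
    using r b by (auto simp: R_def min_def)
  obtain p where p: "hball p (\<mu> * R) \<subseteq> hball q0 R - D"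
    using b(2)[OF R(1,3)] by blast
  have pq0: "hdist q0 p < R"
  proof -
    have "p \<in> hball p (\<mu> * R)"
      using cork(1) R(1) by (simp add: hball_def)
    then have "p \<in> hball q0 R"
      using p by blast
    then show ?thesis
      by (simp add: hball_def)
  qed
  define T where "T q = hdil (1 / R) (hinv p *\<^sub>H q)" for q
  have kT: "koranyi (T q) = hdist p q / R" for q
    using R by (simp add: T_def koranyi_hdil hdist_def)
  define f where "f q = exp (- s * quartic k q)" for q
  have f: "0 < f q" "f q \<le> 1" for q
    using s quartic_nonneg[of k q] by (auto simp: f_def)
  \<comment> \<open>Normalises \<open>w\<close> so that \<open>w q < h\<close> means exactly
    \<open>quartic k (T q) < 18\<close>.\<close>
  define d where "d = 1 - exp (- s * 18)"
  have d: "0 < d"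
    using s by (simp add: d_def)
  define w where "w q = h / d * (1 - f (T q))" for q
  have w0: "0 \<le> w q" "\<bar>w q\<bar> \<le> h / d" for q
  proof -
    have "0 \<le> h / d"
      using d h by simp
    then have "0 \<le> w q" "w q \<le> h / d"
      unfolding w_def using f[of "T q"] by (auto intro!: mult_nonneg_nonneg mult_left_le simp del: times_divide_eq_left)
    then show "0 \<le> w q" "\<bar>w q\<bar> \<le> h / d"
      by simp_all
  qed
  have cT: "continuous_on UNIV T"
    unfolding T_def by (intro continuous_on_hdil continuous_on_hmul continuous_on_const continuous_on_id)
  have cf: "continuous_on UNIV f"
    unfolding f_def by (intro continuous_on_exp continuous_on_mult continuous_on_const continuous_on_quartic continuous_on_id)
  have cfT: "continuous_on UNIV (\<lambda>q. f (T q))"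
    using cf cT by (rule continuous_on_compose2) simp
  then have "continuous_on UNIV w"
    unfolding w_def by (intro continuous_on_mult continuous_on_diff continuous_on_const)
  then have w: "w \<in> borel_measurable borel"
    by (rule borel_measurable_continuous_onI)
  \<comment> \<open>On the shell between \<open>4 R\<close> and \<open>5 R\<close> one has
    \<open>w \<ge> h \<ge> U\<close>, so the minimum already equals \<open>U\<close> before the
    cut-off.\<close>
  define U' where "U' q = (if q \<in> hball q0 (5 * R) then min (U q) (w q) else U q)" for q
  have [measurable]: "U \<in> borel_measurable borel" "w \<in> borel_measurable borel" "T \<in> borel_measurable borel"
    using U w cT by (auto intro: borel_measurable_continuous_onI)
  have U'm: "U' \<in> borel_measurable borel"
    unfolding U'_def by measurable
  have U'01: "0 \<le> U' q" "U' q \<le> U q" for q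
    using U w0 by (auto simp: U'_def)
  have U'b: "\<bar>U' q\<bar> \<le> 1" for q
    using U'01[of q] U(3)[of q] by linarith
  have step: "\<exists>S c. strict_step D g e U' S c" if e: "0 < e" "e < min e0 (min (e1 * R) (R / (g + 1)))" for e
  proof -
    obtain S1 c1 where 1: "S1 \<in> borel_measurable borel" "\<And>q. S1 q \<in> hball 0 1" "0 < c1"
      "\<And>q b. q \<in> D \<Longrightarrow> U q < 1 \<Longrightarrow> b \<in> hball 0 1 \<Longrightarrow>
        move_mean g e U q (S1 q) + move_mean g e U q b + move_mean g e U q 0 \<le> 3 * (U q - c1)"
      using e0(2)[of e] e by (auto simp: strict_step_def)
    have "0 < e / R" "e / R < e1"
      using e R by (auto simp: pos_divide_less_eq)
    then obtain S2 c2 where 2: "S2 \<in> borel_measurable borel" "\<And>q. S2 q \<in> hball 0 1" "0 < c2"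
      "\<And>q b. koranyi q < 3 \<Longrightarrow> k\<^sup>2 \<le> quartic k q \<Longrightarrow> b \<in> hball 0 1 \<Longrightarrow>
        3 * (f q * (1 + c2)) \<le> move_mean g (e / R) f q (S2 q) + move_mean g (e / R) f q b + move_mean g (e / R) f q 0"
      using sup[of "e / R"] unfolding f_def k_def by blast
    define S where "S q = (if q \<in> hball q0 (5 * R) \<and> w q < U q then S2 (T q) else S1 q)" for q
    note [measurable] = 1(1) 2(1)
    have S: "S \<in> borel_measurable borel"
      unfolding S_def by measurable
    \<comment> \<open>Where \<open>w < U\<close>, the value \<open>f (T q)\<close> exceeds
      \<open>exp (- s * 18)\<close>; this turns the relative gain \<open>c2\<close> into a uniform
      absolute one.\<close>
    define c where "c = min c1 (h / d * exp (- s * 18) * c2)"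
    have c: "0 < c"
      using 1 2 h d by (simp add: c_def)
    have "move_mean g e U' q (S q) + move_mean g e U' q b + move_mean g e U' q 0 \<le> 3 * (U' q - c)"
      if q: "q \<in> D" "U' q < 1" and b: "b \<in> hball 0 1" for q b
    proof (cases "q \<in> hball q0 (5 * R) \<and> w q < U q")
      case False
      then have eq: "U' q = U q" "S q = S1 q"
        by (auto simp: U'_def S_def)
      \<comment> \<open>The new function equals \<open>U\<close> at \<open>q\<close> and is nowhere
        larger, so the old inequality is inherited.\<close>
      have "move_mean g e U' q a \<le> move_mean g e U q a" for a
        using U'01 U by (intro move_mean_mono[where B=1 and B'=1] U'm U'b) auto
      then have "move_mean g e U' q (S q) + move_mean g e U' q b + move_mean g e U' q 0
          \<le> move_mean g e U q (S1 q) + move_mean g e U q b + move_mean g e U q 0"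
        unfolding eq by (intro add_mono)
      also have "\<dots> \<le> 3 * (U q - c1)"
        using 1(4)[OF q(1) _ b] q(2) eq by simp
      also have "\<dots> \<le> 3 * (U' q - c)"
        by (simp add: eq c_def)
      finally show ?thesis .
    next
      case True
      then have eq: "U' q = w q" "S q = S2 (T q)"
        by (auto simp: U'_def S_def)
      have "q \<in> hball q0 r"
        using True R by (auto simp: hball_def)
      then have "w q < h"
        using Ur[of q] True by linarith
      then have "h * (1 - f (T q)) < h * d"
        using d by (simp add: w_def pos_divide_less_eq)
      then have fl: "exp (- s * 18) < f (T q)"
        using h by (simp add: d_def)
      then have "quartic k (T q) < 18"
        using s by (simp add: f_def)
      then have k3: "koranyi (T q) < 3"
        using k by (intro koranyi_less_3)
      have "q \<notin> hball p (\<mu> * R)"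
        using p q by blast
      then have "\<mu> \<le> koranyi (T q)"
        using R by (simp add: kT hball_def pos_le_divide_eq)
      then have gk: "k\<^sup>2 \<le> quartic k (T q)"
        unfolding k_def using cork(1) by (intro quartic_ge_sq) auto
      have "hdist q0 q < 4 * R"
        using hdist_triangle[of q0 q p] pq0 k3 R by (simp add: kT pos_divide_less_eq)
      have mm: "move_mean g e U' q a \<le> h / d * (1 - move_mean g (e / R) f (T q) a)" if a: "a \<in> hball 0 1" for a
      proof -
        \<comment> \<open>\<open>U'\<close> lies below \<open>w\<close> only inside the ball of
          radius \<open>5 R\<close>, hence the control on where the move lands.\<close>
        have "move_mean g e U' q a \<le> move_mean g e w q a"
        proof (rule move_mean_mono[OF U'm U'b w w0(2)])
          fix x assume x: "x \<in> hball 0 1"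
          let ?q = "q *\<^sub>H hdil (g * e) a *\<^sub>H hdil e x"
          have "(g + 1) * e < R"
            using e g by (simp add: pos_less_divide_eq mult.commute)
          then have "hdist q0 ?q < 5 * R"
            using hdist_triangle[of q0 ?q q] hdist_move[OF g e(1) a x, of q] \<open>hdist q0 q < 4 * R\<close> by linarith
          then show "U' ?q \<le> w ?q"
            by (simp add: U'_def hball_def)
        qed
        also have "\<dots> = h / d * (1 - move_mean g e (\<lambda>q. f (T q)) q a)"
        proof -
          interpret prob_space noise
            by (rule prob_space_noise)
          have "integrable noise (\<lambda>x. f (T (q *\<^sub>H hdil (g * e) a *\<^sub>H hdil e x)))"
            using f cfT by (intro integrable_move[where B=1] borel_measurable_continuous_onI) (auto simp: abs_of_pos)
          then show ?thesis
            unfolding move_mean_def w_def using prob_space by simp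
        qed
        also have "move_mean g e (\<lambda>q. f (T q)) q a = move_mean g (e / R) f (T q) a"
          unfolding T_def by (rule move_mean_rescale[OF R(1)])
        finally show ?thesis .
      qed
      have "move_mean g e U' q (S q) + move_mean g e U' q b + move_mean g e U' q 0
          \<le> h / d * (1 - move_mean g (e / R) f (T q) (S2 (T q))) + h / d * (1 - move_mean g (e / R) f (T q) b)
            + h / d * (1 - move_mean g (e / R) f (T q) 0)"
        unfolding eq using 2(2) b zero_mem_hball_0 by (intro add_mono mm)
      also have "\<dots> = h / d * (3 - (move_mean g (e / R) f (T q) (S2 (T q)) + move_mean g (e / R) f (T q) b
            + move_mean g (e / R) f (T q) 0))"
        by (simp add: algebra_simps)
      also have "\<dots> \<le> h / d * (3 - 3 * (f (T q) * (1 + c2)))"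
        using 2(4)[OF k3 gk b] h d by (intro mult_left_mono) auto
      also have "\<dots> = 3 * (w q - h / d * f (T q) * c2)"
        by (simp add: w_def algebra_simps)
      also have "\<dots> \<le> 3 * (U' q - c)"
      proof -
        have "h / d * exp (- s * 18) * c2 \<le> h / d * f (T q) * c2"
          using fl h d 2(3) by (intro mult_right_mono mult_left_mono) auto
        then show ?thesis
          unfolding eq c_def by (simp add: min_def)
      qed
      finally show ?thesis .
    qed
    moreover have "S q \<in> hball 0 1" for q
      using 1 2 by (simp add: S_def)
    ultimately show ?thesis
      using S c unfolding strict_step_def by blast
  qed
  have "U' q \<le> h * ((1 - exp (- s * 17)) / (1 - exp (- s * 18)))" if q: "q \<in> hball q0 R" for q
  proof -
    have "hdist p q < 2 * R"
      using hdist_triangle[of p q q0] pq0 q by (simp add: hball_def hdist_commute)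
    then have "koranyi (T q) < 2"
      using R by (simp add: kT pos_divide_less_eq)
    then have "quartic k (T q) \<le> 17"
      using k by (intro quartic_le_17)
    then have "exp (- s * 17) \<le> f (T q)"
      using s by (simp add: f_def)
    then have "w q \<le> h / d * (1 - exp (- s * 17))"
      unfolding w_def using h d by (intro mult_left_mono) auto
    moreover have "U' q \<le> w q"
      using q R by (auto simp: U'_def hball_def)
    ultimately show ?thesis
      by (simp add: d_def)
  qed
  moreover have "q \<in> hball q0 \<delta>" if "U' q < 1" for q
    using that U(4)[of q] R r by (auto simp: U'_def hball_def split: if_splits)
  moreover have "0 < min e0 (min (e1 * R) (R / (g + 1)))"
    using e0 e1 R g by simp
  moreover have "U' q \<le> 1" for q
    using U'01(2)[of q] U(3)[of q] by linarith
  ultimately have "barrier D g q0 \<delta> (h * ((1 - exp (- s * 17)) / (1 - exp (- s * 18)))) U' R"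
    unfolding barrier_def using U'm U'01 R r step by (intro conjI allI ballI impI exI[of _ "min e0 (min (e1 * R) (R / (g + 1)))"]) auto
  then show ?thesis
    by blast
qed

text \<open>Each refinement gains the same factor \<open>t < 1\<close>, because \<open>s\<close> is
  fixed before the induction and does not change with the radius.\<close>

lemma barrier_exists:
  assumes cork: "exterior_corkscrew D q0" and g: "0 \<le> g" and "0 < \<delta>" "0 < \<eta>"
  shows "\<exists>U r. barrier D g q0 \<delta> \<eta> U r"
proof -
  obtain \<mu> where \<mu>: "\<mu> \<in> {0<..<1}" "\<forall>\<^sub>F r in at_right 0. \<exists>p0. hball p0 (\<mu> * r) \<subseteq> hball q0 r - D"
    using cork by (auto simp: exterior_corkscrew_def)
  have "\<mu>\<^sup>2 < 1"
    using \<mu>(1) by (simp add: power_less_one_iff abs_square_less_1)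
  then have k: "0 < \<mu>\<^sup>2 / 2" "\<mu>\<^sup>2 / 2 < 1"
    using \<mu>(1) by auto
  obtain s e1 where s: "0 < s" "0 < e1" and sup:
    "\<And>e. 0 < e \<Longrightarrow> e < e1 \<Longrightarrow> \<exists>S c. S \<in> borel_measurable borel \<and> (\<forall>q. S q \<in> hball 0 1) \<and> 0 < c \<and>
      (\<forall>q b. koranyi q < 3 \<longrightarrow> (\<mu>\<^sup>2 / 2)\<^sup>2 \<le> quartic (\<mu>\<^sup>2 / 2) q \<longrightarrow> b \<in> hball 0 1 \<longrightarrow>
        3 * (exp (- s * quartic (\<mu>\<^sup>2 / 2) q) * (1 + c)) \<le> move_mean g e (\<lambda>q. exp (- s * quartic (\<mu>\<^sup>2 / 2) q)) q (S q)
          + move_mean g e (\<lambda>q. exp (- s * quartic (\<mu>\<^sup>2 / 2) q)) q b + move_mean g e (\<lambda>q. exp (- s * quartic (\<mu>\<^sup>2 / 2) q)) q 0)"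
    using exp_quartic_supersolution[OF k g] by blast
  define t where "t = (1 - exp (- s * 17)) / (1 - exp (- s * 18))"
  have t: "0 < t" "t < 1"
    using s by (auto simp: t_def)
  have ex: "\<exists>U r. barrier D g q0 \<delta> (t ^ n) U r" for n
  proof (induction n)
    case 0
    \<comment> \<open>For the constant 1 the step inequality is vacuous, since
      \<open>U q < 1\<close> never holds.\<close>
    have "barrier D g q0 \<delta> (t ^ 0) (\<lambda>_. 1) \<delta>"
      unfolding barrier_def strict_step_def using \<open>0 < \<delta>\<close>
      using zero_mem_hball_0 by (auto intro!: exI[of _ "1::real"] exI[of _ "\<lambda>_::heis. 0::heis"])
    then show ?case
      by blast
  next
    case (Suc n)
    then obtain U r where "barrier D g q0 \<delta> (t ^ n) U r"
      by blast
    from barrier_refine[OF \<mu> g s sup this, folded t_def] t show ?case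
      unfolding power_Suc2 by simp
  qed
  obtain n where "t ^ n < \<eta>"
    using real_arch_pow_inv[OF \<open>0 < \<eta>\<close> t(2)] by blast
  moreover obtain U r where "barrier D g q0 \<delta> (t ^ n) U r"
    using ex by blast
  ultimately have "barrier D g q0 \<delta> \<eta> U r"
    unfolding barrier_def by force
  then show ?thesis
    by blast
qed

section \<open>The probability space and the positions\<close>

lemma Omega1_eq:
  "Omega1 = noise \<Otimes>\<^sub>M (uniform_count_measure {1, 2, 3} \<Otimes>\<^sub>M restrict_space lborel {0<..<1})"
  by (simp add: Omega1_def noise_def)

lemma prob_space_coin: "prob_space (uniform_count_measure {1, 2, 3 :: nat})"
  by (rule prob_spaceI) (simp add: space_uniform_count_measure emeasure_uniform_count_measure)

lemma prob_space_unit_interval: "prob_space (restrict_space lborel {0<..<1 :: real})"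
  by (rule prob_spaceI) (simp add: space_restrict_space emeasure_restrict_space)

lemma prob_space_Omega1: "prob_space Omega1"
  unfolding Omega1_eq by (intro prob_space_pair prob_space_noise prob_space_coin prob_space_unit_interval)

lemma space_Omega1: "space Omega1 = hball 0 1 \<times> {1, 2, 3} \<times> {0<..<1}"
  by (simp add: Omega1_eq space_pair_measure space_uniform_count_measure space_restrict_space)

lemma measurable_fst_Omega1 [measurable]: "fst \<in> borel_measurable Omega1"
  unfolding Omega1_eq by (rule measurable_compose[OF measurable_fst measurable_noise, of "\<lambda>w. w", simplified])

lemma measurable_coin_Omega1 [measurable]: "(\<lambda>y. fst (snd y)) \<in> measurable Omega1 (count_space UNIV)"
proof -
  have "(\<lambda>s. s) \<in> measurable (uniform_count_measure {1, 2, 3 :: nat}) (count_space UNIV)"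
    by (simp add: measurable_def sets_uniform_count_measure space_uniform_count_measure)
  then show ?thesis
    unfolding Omega1_eq by (rule measurable_compose[OF measurable_compose[OF measurable_snd measurable_fst]])
qed

lemma measurable_time_Omega1 [measurable]: "(\<lambda>y. snd (snd y)) \<in> borel_measurable Omega1"
proof -
  have "(\<lambda>t. t) \<in> borel_measurable (restrict_space lborel {0<..<1 :: real})"
    by (rule measurable_restrict_space1) simp
  then show ?thesis
    unfolding Omega1_eq by (rule measurable_compose[OF measurable_compose[OF measurable_snd measurable_snd]])
qed

lemma hdil_0: "hdil l 0 = 0"
  by (simp add: hdil_def zero_prod_def)

definition advance :: "real \<Rightarrow> real \<Rightarrow> heis \<Rightarrow> heis \<Rightarrow> heis \<Rightarrow> outcome \<Rightarrow> heis" where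
  "advance g e q a b y = (if fst (snd y) = 1 then q *\<^sub>H hdil (g * e) a *\<^sub>H hdil e (fst y)
     else if fst (snd y) = 2 then q *\<^sub>H hdil (g * e) b *\<^sub>H hdil e (fst y) else q *\<^sub>H hdil e (fst y))"

lemma measurable_advance:
  assumes [measurable]: "q \<in> borel_measurable M" "a \<in> borel_measurable M" "b \<in> borel_measurable M" "y \<in> measurable M Omega1"
  shows "(\<lambda>x. advance g e (q x) (a x) (b x) (y x)) \<in> borel_measurable M"
proof -
  have [measurable]: "(\<lambda>x. fst (y x)) \<in> borel_measurable M" "(\<lambda>x. fst (snd (y x))) \<in> measurable M (count_space UNIV)"
    by (rule measurable_compose[OF assms(4)], rule measurable_fst_Omega1 measurable_coin_Omega1)+
  show ?thesis
    unfolding advance_def by measurable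
qed

lemma measurable_advance_value:
  assumes "U \<in> borel_measurable borel"
  shows "(\<lambda>y. ennreal (U (advance g e q a b y))) \<in> borel_measurable Omega1"
proof -
  have "(\<lambda>y. advance g e q a b y) \<in> borel_measurable Omega1"
    by (rule measurable_advance) (rule measurable_const measurable_ident_sets refl; simp)+
  from measurable_compose[OF measurable_compose[OF this assms] measurable_ennreal] show ?thesis .
qed

lemma nn_integral_coin: "(\<integral>\<^sup>+s. f s \<partial>uniform_count_measure {1, 2, 3 :: nat}) = (f 1 + f 2 + f 3) * ennreal (1 / 3)"
  unfolding uniform_count_measure_def
  by (subst nn_integral_point_measure_finite) (simp_all add: distrib_left mult.commute add.assoc)

lemma nn_integral_advance:
  assumes U: "U \<in> borel_measurable borel" "\<And>q. 0 \<le> U q" "\<And>q. U q \<le> 1"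
  shows "(\<integral>\<^sup>+y. ennreal (U (advance g e q a b y)) \<partial>Omega1)
    = ennreal ((move_mean g e U q a + move_mean g e U q b + move_mean g e U q 0) / 3)"
proof -
  let ?C = "uniform_count_measure {1, 2, 3 :: nat}" and ?T = "restrict_space lborel {0<..<1 :: real}"
  interpret C: prob_space ?C by (rule prob_space_coin)
  interpret T: prob_space ?T by (rule prob_space_unit_interval)
  interpret CT: prob_space "?C \<Otimes>\<^sub>M ?T" by (intro prob_space_pair prob_space_coin prob_space_unit_interval)
  let ?u = "\<lambda>a w. U (q *\<^sub>H hdil (g * e) a *\<^sub>H hdil e w)"
  have u3: "U (q *\<^sub>H hdil e w) = ?u 0 w" for w
    by (simp add: hdil_0)
  have [measurable]: "U \<in> borel_measurable borel" by (rule U)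
  have m: "(\<lambda>y. ennreal (U (advance g e q a b y))) \<in> borel_measurable Omega1"
    by (rule measurable_advance_value[OF U(1)])
  then have "(\<integral>\<^sup>+y. ennreal (U (advance g e q a b y)) \<partial>Omega1)
      = (\<integral>\<^sup>+w. \<integral>\<^sup>+z. ennreal (U (advance g e q a b (w, z))) \<partial>(?C \<Otimes>\<^sub>M ?T) \<partial>noise)"
    unfolding Omega1_eq by (rule CT.nn_integral_fst[symmetric])
  also have "\<dots> = (\<integral>\<^sup>+w. ennreal ((?u a w + ?u b w + ?u 0 w) / 3) \<partial>noise)"
  proof (rule nn_integral_cong)
    fix w assume w: "w \<in> space noise"
    have "(\<lambda>z. (w, z)) \<in> measurable (?C \<Otimes>\<^sub>M ?T) Omega1"
      unfolding Omega1_eq using w by simp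
    then have "(\<lambda>z. ennreal (U (advance g e q a b (w, z)))) \<in> borel_measurable (?C \<Otimes>\<^sub>M ?T)"
      using m by (rule measurable_compose)
    then have "(\<integral>\<^sup>+z. ennreal (U (advance g e q a b (w, z))) \<partial>(?C \<Otimes>\<^sub>M ?T))
        = (\<integral>\<^sup>+s. \<integral>\<^sup>+t. ennreal (U (advance g e q a b (w, s, t))) \<partial>?T \<partial>?C)"
      by (rule T.nn_integral_fst[symmetric])
    \<comment> \<open>The move ignores the clock, so 0 stands in for its value and the clock
      integrates to 1.\<close>
    also have "\<dots> = (\<integral>\<^sup>+s. ennreal (U (advance g e q a b (w, s, 0))) \<partial>?C)"
    proof (rule nn_integral_cong)
      fix s
      have "(\<integral>\<^sup>+t. ennreal (U (advance g e q a b (w, s, t))) \<partial>?T) = (\<integral>\<^sup>+t. ennreal (U (advance g e q a b (w, s, 0))) \<partial>?T)"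
        by (rule nn_integral_cong) (simp add: advance_def)
      also have "\<dots> = ennreal (U (advance g e q a b (w, s, 0)))"
        using T.emeasure_space_1 by (simp only: nn_integral_const mult_1_right)
      finally show "(\<integral>\<^sup>+t. ennreal (U (advance g e q a b (w, s, t))) \<partial>?T) = ennreal (U (advance g e q a b (w, s, 0)))" .
    qed
    also have "\<dots> = (ennreal (?u a w) + ennreal (?u b w) + ennreal (?u 0 w)) * ennreal (1 / 3)"
      unfolding nn_integral_coin by (simp add: advance_def u3)
    also have "\<dots> = ennreal ((?u a w + ?u b w + ?u 0 w) / 3)"
      using U by (simp add: ennreal_plus[symmetric] ennreal_mult[symmetric] del: ennreal_plus)
    finally show "(\<integral>\<^sup>+z. ennreal (U (advance g e q a b (w, z))) \<partial>(?C \<Otimes>\<^sub>M ?T)) = ennreal ((?u a w + ?u b w + ?u 0 w) / 3)" .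
  qed
  also have "\<dots> = ennreal (\<integral>w. (?u a w + ?u b w + ?u 0 w) / 3 \<partial>noise)"
  proof (rule nn_integral_eq_integral)
    show "integrable noise (\<lambda>w. (?u a w + ?u b w + ?u 0 w) / 3)"
      using U by (intro integrable_divide Bochner_Integration.integrable_add integrable_move[where B=1]) auto
  qed (use U in simp)
  also have "(\<integral>w. (?u a w + ?u b w + ?u 0 w) / 3 \<partial>noise) = (move_mean g e U q a + move_mean g e U q b + move_mean g e U q 0) / 3"
  proof -
    have "integrable noise (?u a)" for a
      using U by (intro integrable_move[where B=1]) auto
    then show ?thesis
      by (simp add: move_mean_def)
  qed
  finally show ?thesis .
qed

lemma position_Suc:
  "position p \<epsilon> q0 \<sigma>I \<sigma>II \<omega> (Suc n) = advance (gamma_p p) \<epsilon> (position p \<epsilon> q0 \<sigma>I \<sigma>II \<omega> n)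
     (\<sigma>I n (q0, \<lambda>i\<in>{1..n}. (position p \<epsilon> q0 \<sigma>I \<sigma>II \<omega> i, \<omega> i)))
     (\<sigma>II n (q0, \<lambda>i\<in>{1..n}. (position p \<epsilon> q0 \<sigma>I \<sigma>II \<omega> i, \<omega> i))) (\<omega> (Suc n))"
  by (simp add: advance_def Let_def split: prod.split)

declare position.simps(2) [simp del]

text \<open>This allows events up to time \<open>n\<close> to be computed on a finite product. The
  history contains all earlier positions, so the induction is over all smaller indices.\<close>

lemma position_cong:
  "(\<And>i. 1 \<le> i \<Longrightarrow> i \<le> n \<Longrightarrow> \<omega> i = \<omega>' i) \<Longrightarrow> position p \<epsilon> q0 \<sigma>I \<sigma>II \<omega> n = position p \<epsilon> q0 \<sigma>I \<sigma>II \<omega>' n"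
proof (induction n rule: less_induct)
  case (less n)
  show ?case
  proof (cases n)
    case (Suc m)
    have eq: "position p \<epsilon> q0 \<sigma>I \<sigma>II \<omega> i = position p \<epsilon> q0 \<sigma>I \<sigma>II \<omega>' i" if "i \<le> m" for i
      using that Suc less by simp
    have "(\<lambda>i\<in>{1..m}. (position p \<epsilon> q0 \<sigma>I \<sigma>II \<omega> i, \<omega> i)) = (\<lambda>i\<in>{1..m}. (position p \<epsilon> q0 \<sigma>I \<sigma>II \<omega>' i, \<omega>' i))"
      using less.prems Suc eq by (intro restrict_ext) simp
    then show ?thesis
      unfolding Suc position_Suc using less.prems[of "Suc m"] Suc eq[of m] by simp
  qed simp
qed

text \<open>The index set is left general because both finite products and the infinite product
  \<open>Omega\<close> occur below.\<close>

lemma measurable_position_history: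
  assumes \<sigma>: "is_strategy \<sigma>I" "is_strategy \<sigma>II" and I: "{1..n} \<subseteq> I"
  shows "(\<lambda>\<omega>. position p \<epsilon> q0 \<sigma>I \<sigma>II \<omega> n) \<in> borel_measurable (PiM I (\<lambda>_. Omega1))"
    and "(\<lambda>\<omega>. (q0, \<lambda>i\<in>{1..n}. (position p \<epsilon> q0 \<sigma>I \<sigma>II \<omega> i, \<omega> i))) \<in> measurable (PiM I (\<lambda>_. Omega1)) (history_space n)"
proof -
  let ?M = "PiM I (\<lambda>_. Omega1)"
  have hist: "(\<lambda>\<omega>. (q0, \<lambda>i\<in>{1..n}. (position p \<epsilon> q0 \<sigma>I \<sigma>II \<omega> i, \<omega> i))) \<in> measurable ?M (history_space n)"
    if "{1..n} \<subseteq> I" "\<And>i. i \<le> n \<Longrightarrow> (\<lambda>\<omega>. position p \<epsilon> q0 \<sigma>I \<sigma>II \<omega> i) \<in> borel_measurable ?M" for n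
    unfolding history_space_def
  proof (intro measurable_Pair measurable_restrict)
    fix i assume "i \<in> {1..n}"
    then show "(\<lambda>\<omega>. position p \<epsilon> q0 \<sigma>I \<sigma>II \<omega> i) \<in> borel_measurable ?M" "(\<lambda>\<omega>. \<omega> i) \<in> measurable ?M Omega1"
      using that by (auto intro: measurable_component_singleton)
  qed simp
  have *: "{1..n} \<subseteq> I \<Longrightarrow> (\<lambda>\<omega>. position p \<epsilon> q0 \<sigma>I \<sigma>II \<omega> n) \<in> borel_measurable ?M" for n
  proof (induction n rule: less_induct)
    case (less n)
    show ?case
    proof (cases n)
      case (Suc m)
      have pos: "(\<lambda>\<omega>. position p \<epsilon> q0 \<sigma>I \<sigma>II \<omega> i) \<in> borel_measurable ?M" if "i \<le> m" for i
        using less.prems that Suc by (intro less.IH) auto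
      have "(\<lambda>\<omega>. \<sigma> m (q0, \<lambda>i\<in>{1..m}. (position p \<epsilon> q0 \<sigma>I \<sigma>II \<omega> i, \<omega> i))) \<in> borel_measurable ?M"
        if "is_strategy \<sigma>" for \<sigma>
        using that less.prems Suc unfolding is_strategy_def measurable_restrict_space2_iff
        by (intro measurable_compose[OF hist[OF _ pos], of m "\<sigma> m" borel]) auto
      moreover have "(\<lambda>\<omega>. \<omega> (Suc m)) \<in> measurable ?M Omega1"
        using less.prems Suc by (intro measurable_component_singleton) auto
      ultimately show ?thesis
        unfolding Suc position_Suc using \<sigma> pos by (intro measurable_advance) auto
    qed simp
  qed
  show "(\<lambda>\<omega>. position p \<epsilon> q0 \<sigma>I \<sigma>II \<omega> n) \<in> borel_measurable ?M"
    using I by (rule *)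
  show "(\<lambda>\<omega>. (q0, \<lambda>i\<in>{1..n}. (position p \<epsilon> q0 \<sigma>I \<sigma>II \<omega> i, \<omega> i))) \<in> measurable ?M (history_space n)"
    using I by (intro hist *) auto
qed

lemma hsetdist_nonmember:
  assumes "q \<notin> D"
  shows "hsetdist q (- D) = 0"
proof (rule antisym)
  have "bdd_below (hdist q ` (- D))"
    by (rule bdd_belowI2[of _ 0]) (rule hdist_nonneg)
  from cINF_lower[OF this, of q] show "hsetdist q (- D) \<le> 0"
    using assms by (simp add: hsetdist_def)
  show "0 \<le> hsetdist q (- D)"
    unfolding hsetdist_def using assms by (intro cINF_greatest hdist_nonneg) auto
qed

lemma d_eps_nonmember: "q \<notin> D \<Longrightarrow> 0 < \<epsilon> \<Longrightarrow> d_eps D \<epsilon> q = 0"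
  by (simp add: d_eps_def hsetdist_nonmember)

text \<open>Strict sublevel sets of the distance are unions of open sets over the complement, which
  must be nonempty for the infimum to be meaningful.\<close>

lemma measurable_d_eps:
  assumes "D \<noteq> UNIV"
  shows "d_eps D \<epsilon> \<in> borel_measurable borel"
proof -
  have bdd: "bdd_below (hdist q ` (- D))" for q
    by (rule bdd_belowI2[of _ 0]) (rule hdist_nonneg)
  have "{q. hsetdist q (- D) < a} = (\<Union>x\<in>- D. {q. hdist q x < a})" for a
    unfolding hsetdist_def using assms by (subst cINF_less_iff[OF _ bdd]) auto
  moreover have "open (\<Union>x\<in>- D. {q. hdist q x < a})" for a
    by (intro open_UN ballI open_Collect_less continuous_on_hdist continuous_on_id continuous_on_const)
  ultimately have "(\<lambda>q. hsetdist q (- D)) \<in> borel_measurable borel"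
    by (subst borel_measurable_iff_less) (simp add: borel_open)
  then show ?thesis
    unfolding d_eps_def[abs_def] by simp
qed

section \<open>The game with a barrier\<close>

text \<open>A strategy that sees only the current position. That is the last entry of the history,
  except at length 0, where only the initial position is recorded.\<close>

definition pull :: "(heis \<Rightarrow> heis) \<Rightarrow> strategy" where
  "pull S n h = S (if n = 0 then fst h else fst (snd h n))"

lemma is_strategy_pull:
  assumes S: "S \<in> borel_measurable borel" "\<And>q. S q \<in> hball 0 1"
  shows "is_strategy (pull S)"
  unfolding is_strategy_def measurable_restrict_space2_iff
proof (intro allI conjI)
  fix n
  show "pull S n \<in> space (history_space n) \<rightarrow> hball 0 1"
    using S by (simp add: pull_def)
  have "(\<lambda>h. if n = 0 then fst h else fst (snd h n)) \<in> borel_measurable (history_space n)"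
  proof (cases "n = 0")
    case False
    have "(\<lambda>H. H n) \<in> measurable (PiM {1..n} (\<lambda>_. borel \<Otimes>\<^sub>M Omega1)) (borel \<Otimes>\<^sub>M Omega1)"
      using False by (intro measurable_component_singleton) auto
    from measurable_compose[OF measurable_compose[OF measurable_snd this] measurable_fst] False show ?thesis
      by (simp add: history_space_def)
  qed (simp add: history_space_def)
  from measurable_compose[OF this S(1)] show "pull S n \<in> borel_measurable (history_space n)"
    by (simp add: pull_def[abs_def])
qed

lemma pull_position:
  "pull S n (p0, \<lambda>i\<in>{1..n}. (position p \<epsilon> p0 \<sigma>I \<sigma>II \<omega> i, \<omega> i)) = S (position p \<epsilon> p0 \<sigma>I \<sigma>II \<omega> n)"
  by (cases n) (simp_all add: pull_def)

locale barrier_game =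
  fixes p \<epsilon> c :: real and D :: "heis set" and p0 :: heis and U :: "heis \<Rightarrow> real" and S :: "heis \<Rightarrow> heis" and \<sigma>II :: strategy
  assumes eps: "0 < \<epsilon>" and D: "D \<noteq> UNIV"
    and U: "U \<in> borel_measurable borel" "\<And>q. 0 \<le> U q" "\<And>q. U q \<le> 1"
    and step: "strict_step D (gamma_p p) \<epsilon> U S c" and strat: "is_strategy \<sigma>II"
begin

abbreviation "pos \<omega> n \<equiv> position p \<epsilon> p0 (pull S) \<sigma>II \<omega> n"

abbreviation "continues n \<omega> \<equiv> snd (snd (\<omega> (Suc n))) \<le> d_eps D \<epsilon> (pos \<omega> n)"

text \<open>At each time an outcome is alive, has escaped, or was stopped at a position with
  \<open>U < 1\<close>; the third case is success for player I.\<close>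

primrec alive :: "nat \<Rightarrow> (nat \<Rightarrow> outcome) \<Rightarrow> bool" where
  "alive 0 \<omega> \<longleftrightarrow> U p0 < 1"
| "alive (Suc n) \<omega> \<longleftrightarrow> alive n \<omega> \<and> continues n \<omega> \<and> U (pos \<omega> (Suc n)) < 1"

primrec escaped :: "nat \<Rightarrow> (nat \<Rightarrow> outcome) \<Rightarrow> bool" where
  "escaped 0 \<omega> \<longleftrightarrow> U p0 = 1"
| "escaped (Suc n) \<omega> \<longleftrightarrow> escaped n \<omega> \<or> alive n \<omega> \<and> continues n \<omega> \<and> U (pos \<omega> (Suc n)) = 1"

text \<open>The barrier along the game, frozen at 1 after escape and set to 0 after stopping, so
  that its mean bounds the probability of escape.\<close>

definition potential :: "nat \<Rightarrow> (nat \<Rightarrow> outcome) \<Rightarrow> real" where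
  "potential n \<omega> = (if escaped n \<omega> then 1 else if alive n \<omega> then U (pos \<omega> n) else 0)"

lemma pull: "is_strategy (pull S)"
  using step by (intro is_strategy_pull) (auto simp: strict_step_def)

lemma c: "0 < c"
  using step by (simp add: strict_step_def)

section \<open>Dependence on finitely many outcomes, and measurability\<close>

lemma alive_cong: "(\<And>i. 1 \<le> i \<Longrightarrow> i \<le> n \<Longrightarrow> \<omega> i = \<omega>' i) \<Longrightarrow> alive n \<omega> = alive n \<omega>'"
proof (induction n)
  case (Suc n)
  then have "alive n \<omega> = alive n \<omega>'" "pos \<omega> n = pos \<omega>' n" "pos \<omega> (Suc n) = pos \<omega>' (Suc n)" "\<omega> (Suc n) = \<omega>' (Suc n)"
    by (auto intro!: position_cong)
  then show ?case
    by simp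
qed simp

lemma escaped_cong: "(\<And>i. 1 \<le> i \<Longrightarrow> i \<le> n \<Longrightarrow> \<omega> i = \<omega>' i) \<Longrightarrow> escaped n \<omega> = escaped n \<omega>'"
proof (induction n)
  case (Suc n)
  then have "escaped n \<omega> = escaped n \<omega>'" "alive n \<omega> = alive n \<omega>'" "pos \<omega> n = pos \<omega>' n" "pos \<omega> (Suc n) = pos \<omega>' (Suc n)"
    "\<omega> (Suc n) = \<omega>' (Suc n)"
    by (auto intro!: position_cong alive_cong)
  then show ?case
    by simp
qed simp

lemma potential_cong: "(\<And>i. 1 \<le> i \<Longrightarrow> i \<le> n \<Longrightarrow> \<omega> i = \<omega>' i) \<Longrightarrow> potential n \<omega> = potential n \<omega>'"
  unfolding potential_def using escaped_cong[of n \<omega> \<omega>'] alive_cong[of n \<omega> \<omega>'] position_cong[of n \<omega> \<omega>'] by simp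

lemma alive_less_1: "alive n \<omega> \<Longrightarrow> U (pos \<omega> n) < 1"
  by (cases n) auto

lemma escaped_not_alive: "escaped n \<omega> \<Longrightarrow> \<not> alive n \<omega>"
  by (induction n) auto

lemma potential_nonneg: "0 \<le> potential n \<omega>"
  using U by (simp add: potential_def)

lemma measurable_pos:
  "{1..n} \<subseteq> I \<Longrightarrow> (\<lambda>\<omega>. pos \<omega> n) \<in> borel_measurable (PiM I (\<lambda>_. Omega1))"
  by (rule measurable_position_history[OF pull strat])

lemma measurable_continues:
  assumes "{1..Suc n} \<subseteq> I"
  shows "Measurable.pred (PiM I (\<lambda>_. Omega1)) (continues n)"
proof -
  have "(\<lambda>\<omega>. pos \<omega> n) \<in> borel_measurable (PiM I (\<lambda>_. Omega1))"
    using assms by (intro measurable_pos) auto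
  then have m_d: "(\<lambda>\<omega>. d_eps D \<epsilon> (pos \<omega> n)) \<in> borel_measurable (PiM I (\<lambda>_. Omega1))"
    using measurable_d_eps[OF D] by (rule measurable_compose)
  have "(\<lambda>\<omega>. \<omega> (Suc n)) \<in> measurable (PiM I (\<lambda>_. Omega1)) Omega1"
    using assms by (intro measurable_component_singleton) auto
  from measurable_compose[OF this measurable_time_Omega1]
  have "(\<lambda>\<omega>. snd (snd (\<omega> (Suc n)))) \<in> borel_measurable (PiM I (\<lambda>_. Omega1))" .
  then show ?thesis
    using m_d unfolding pred_def by (intro borel_measurable_le)
qed

lemma measurable_alive: "{1..n} \<subseteq> I \<Longrightarrow> Measurable.pred (PiM I (\<lambda>_. Omega1)) (alive n)"
proof (induction n)
  case (Suc n)
  have [measurable]: "Measurable.pred (PiM I (\<lambda>_. Omega1)) (alive n)"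
    using Suc.prems by (intro Suc.IH) auto
  note [measurable] = measurable_continues[OF Suc.prems] measurable_pos[OF Suc.prems] U(1)
  have "alive (Suc n) = (\<lambda>\<omega>. alive n \<omega> \<and> continues n \<omega> \<and> U (pos \<omega> (Suc n)) < 1)"
    by (simp add: fun_eq_iff)
  then show ?case
    by simp
next
  case 0
  have "alive 0 = (\<lambda>\<omega>. U p0 < 1)"
    by (simp add: fun_eq_iff)
  then show ?case
    by simp
qed

lemma measurable_escaped: "{1..n} \<subseteq> I \<Longrightarrow> Measurable.pred (PiM I (\<lambda>_. Omega1)) (escaped n)"
proof (induction n)
  case (Suc n)
  then have I: "{1..n} \<subseteq> I"
    by auto
  have [measurable]: "Measurable.pred (PiM I (\<lambda>_. Omega1)) (escaped n)"
    using I by (rule Suc.IH)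
  note [measurable] = measurable_continues[OF Suc.prems] measurable_pos[OF Suc.prems] U(1) measurable_alive[OF I]
  have "escaped (Suc n) = (\<lambda>\<omega>. escaped n \<omega> \<or> alive n \<omega> \<and> continues n \<omega> \<and> U (pos \<omega> (Suc n)) = 1)"
    by (simp add: fun_eq_iff)
  then show ?case
    by simp
next
  case 0
  have "escaped 0 = (\<lambda>\<omega>. U p0 = 1)"
    by (simp add: fun_eq_iff)
  then show ?case
    by simp
qed

lemma measurable_potential: "{1..n} \<subseteq> I \<Longrightarrow> potential n \<in> borel_measurable (PiM I (\<lambda>_. Omega1))"
proof -
  assume I: "{1..n} \<subseteq> I"
  note [measurable] = measurable_escaped[OF I] measurable_alive[OF I] measurable_pos[OF I] U(1)
  show ?thesis
    unfolding potential_def[abs_def] by measurable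
qed

lemma measurable_ennreal_potential:
  "{1..n} \<subseteq> I \<Longrightarrow> (\<lambda>\<omega>. ennreal (potential n \<omega>)) \<in> borel_measurable (PiM I (\<lambda>_. Omega1))"
  using measurable_potential measurable_ennreal by (rule measurable_compose)

lemma measurable_of_bool_alive:
  "{1..n} \<subseteq> I \<Longrightarrow> (\<lambda>\<omega>. of_bool (alive n \<omega>) :: ennreal) \<in> borel_measurable (PiM I (\<lambda>_. Omega1))"
  by (rule measurable_compose[OF measurable_alive]) simp_all

lemma potential_Suc_le:
  assumes "alive n \<omega>"
  shows "potential (Suc n) \<omega> + c * of_bool (alive (Suc n) \<omega>) \<le> (if continues n \<omega> then U (pos \<omega> (Suc n)) + c else 0)"
proof -
  have "\<not> escaped n \<omega>"
    using assms escaped_not_alive by blast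
  then show ?thesis
    using assms c U(2,3)[of "pos \<omega> (Suc n)"] by (auto simp: potential_def)
qed

text \<open>Only an alive position inside \<open>D\<close> needs \<open>strict_step\<close>. The
  extra term records the gain \<open>c\<close> of every turn survived, from which termination will
  follow.\<close>

lemma potential_step:
  assumes x: "x \<in> space (PiM {1..n} (\<lambda>_. Omega1))"
  shows "(\<integral>\<^sup>+y. ennreal (potential (Suc n) (x(Suc n := y)) + c * of_bool (alive (Suc n) (x(Suc n := y)))) \<partial>Omega1)
    \<le> ennreal (potential n x)"
proof -
  interpret prob_space Omega1
    by (rule prob_space_Omega1)
  have same: "alive n (x(Suc n := y)) = alive n x" "escaped n (x(Suc n := y)) = escaped n x" "pos (x(Suc n := y)) n = pos x n" for y
    by (auto intro!: alive_cong escaped_cong position_cong)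
  consider (esc) "escaped n x" | (alive) "alive n x" "\<not> escaped n x" | (stopped) "\<not> alive n x" "\<not> escaped n x"
    by blast
  then show ?thesis
  proof cases
    case esc
    then have "\<not> alive n x"
      by (rule escaped_not_alive)
    then have "potential (Suc n) (x(Suc n := y)) + c * of_bool (alive (Suc n) (x(Suc n := y))) = 1" for y
      using esc by (simp add: potential_def same)
    then show ?thesis
      using esc emeasure_space_1 by (simp add: potential_def)
  next
    case stopped
    then have "potential (Suc n) (x(Suc n := y)) + c * of_bool (alive (Suc n) (x(Suc n := y))) = 0" for y
      by (simp add: potential_def same)
    then show ?thesis
      by simp
  next
    case alive
    define q where "q = pos x n"
    define b where "b = \<sigma>II n (p0, \<lambda>i\<in>{1..n}. (pos x i, x i))"
    have "(p0, \<lambda>i\<in>{1..n}. (pos x i, x i)) \<in> space (history_space n)"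
      using measurable_space[OF measurable_position_history(2)[OF pull strat order_refl] x] .
    then have b: "b \<in> hball 0 1"
      using strat unfolding is_strategy_def measurable_restrict_space2_iff b_def by blast
    have eq: "pos (x(Suc n := y)) (Suc n) = advance (gamma_p p) \<epsilon> q (S q) b y" for y
    proof -
      have "pos (x(Suc n := y)) i = pos x i" if "i \<le> n" for i
        using that by (intro position_cong) auto
      then have "(\<lambda>i\<in>{1..n}. (pos (x(Suc n := y)) i, (x(Suc n := y)) i)) = (\<lambda>i\<in>{1..n}. (pos x i, x i))"
        by (intro restrict_ext) simp
      then show ?thesis
        unfolding position_Suc pull_position by (simp add: b_def q_def same)
    qed
    have U1: "U q < 1"
      using alive(1) alive_less_1 q_def by blast
    have le: "potential (Suc n) (x(Suc n := y)) + c * of_bool (alive (Suc n) (x(Suc n := y)))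
        \<le> (if snd (snd y) \<le> d_eps D \<epsilon> q then U (advance (gamma_p p) \<epsilon> q (S q) b y) + c else 0)" for y
      using potential_Suc_le[of n "x(Suc n := y)"] alive(1) unfolding eq same q_def[symmetric] by simp
    show ?thesis
    proof (cases "q \<in> D")
      case True
      \<comment> \<open>Forgetting the stopping rule only enlarges the integrand, as
        \<open>U\<close> and \<open>c\<close> are nonnegative.\<close>
      have "(\<integral>\<^sup>+y. ennreal (potential (Suc n) (x(Suc n := y)) + c * of_bool (alive (Suc n) (x(Suc n := y)))) \<partial>Omega1)
          \<le> (\<integral>\<^sup>+y. ennreal (U (advance (gamma_p p) \<epsilon> q (S q) b y)) + ennreal c \<partial>Omega1)"
      proof (rule nn_integral_mono)
        fix y
        have "potential (Suc n) (x(Suc n := y)) + c * of_bool (alive (Suc n) (x(Suc n := y)))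
            \<le> U (advance (gamma_p p) \<epsilon> q (S q) b y) + c"
          using le[of y] c U(2)[of "advance (gamma_p p) \<epsilon> q (S q) b y"] by (auto split: if_splits)
        then show "ennreal (potential (Suc n) (x(Suc n := y)) + c * of_bool (alive (Suc n) (x(Suc n := y))))
            \<le> ennreal (U (advance (gamma_p p) \<epsilon> q (S q) b y)) + ennreal c"
          using c U(2) by (simp add: ennreal_plus[symmetric] ennreal_leI del: ennreal_plus)
      qed
      also have "\<dots> = (\<integral>\<^sup>+y. ennreal (U (advance (gamma_p p) \<epsilon> q (S q) b y)) \<partial>Omega1) + ennreal c"
        using emeasure_space_1 by (subst nn_integral_add) (simp_all add: measurable_advance_value U(1))
      also have "\<dots> = ennreal ((move_mean (gamma_p p) \<epsilon> U q (S q) + move_mean (gamma_p p) \<epsilon> U q b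
          + move_mean (gamma_p p) \<epsilon> U q 0) / 3) + ennreal c"
        by (subst nn_integral_advance[OF U]) simp
      also have "\<dots> = ennreal ((move_mean (gamma_p p) \<epsilon> U q (S q) + move_mean (gamma_p p) \<epsilon> U q b
          + move_mean (gamma_p p) \<epsilon> U q 0) / 3 + c)"
        using c U(2) by (intro ennreal_plus[symmetric]) (auto simp: move_mean_def intro!: add_nonneg_nonneg integral_nonneg_AE)
      also have "\<dots> \<le> ennreal (U q)"
      proof (rule ennreal_leI)
        have "move_mean (gamma_p p) \<epsilon> U q (S q) + move_mean (gamma_p p) \<epsilon> U q b + move_mean (gamma_p p) \<epsilon> U q 0
            \<le> 3 * (U q - c)"
          using step True U1 b unfolding strict_step_def by blast
        then show "(move_mean (gamma_p p) \<epsilon> U q (S q) + move_mean (gamma_p p) \<epsilon> U q b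
            + move_mean (gamma_p p) \<epsilon> U q 0) / 3 + c \<le> U q"
          by argo
      qed
      also have "U q = potential n x"
        using alive by (simp add: potential_def q_def)
      finally show ?thesis .
    next
      case False
      \<comment> \<open>Outside \<open>D\<close> the threshold is 0 while the clock is strictly
        positive, so the game stops here and the integrand vanishes.\<close>
      have "(\<integral>\<^sup>+y. ennreal (potential (Suc n) (x(Suc n := y)) + c * of_bool (alive (Suc n) (x(Suc n := y)))) \<partial>Omega1)
          \<le> (\<integral>\<^sup>+y. 0 \<partial>Omega1)"
      proof (rule nn_integral_mono)
        fix y assume "y \<in> space Omega1"
        then have "0 < snd (snd y)"
          by (auto simp: space_Omega1)
        then show "ennreal (potential (Suc n) (x(Suc n := y)) + c * of_bool (alive (Suc n) (x(Suc n := y)))) \<le> 0"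
          using le[of y] False eps by (simp add: d_eps_nonmember ennreal_neg)
      qed
      then show ?thesis
        by simp
    qed
  qed
qed

section \<open>The supermartingale estimate over many turns\<close>

abbreviation histories :: "nat \<Rightarrow> (nat \<Rightarrow> outcome) measure" where
  "histories n \<equiv> PiM {1..n} (\<lambda>_. Omega1)"

definition mean_potential :: "nat \<Rightarrow> ennreal" where
  "mean_potential n = (\<integral>\<^sup>+\<omega>. ennreal (potential n \<omega>) \<partial>histories n)"

definition prob_alive :: "nat \<Rightarrow> ennreal" where
  "prob_alive n = (\<integral>\<^sup>+\<omega>. of_bool (alive n \<omega>) \<partial>histories n)"

lemma product_prob: "product_prob_space (\<lambda>_ :: nat. Omega1)"
  by (intro product_prob_spaceI prob_space_Omega1)

lemma mean_potential_Suc: "mean_potential (Suc n) + ennreal c * prob_alive (Suc n) \<le> mean_potential n"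
proof -
  interpret product_prob_space "\<lambda>_ :: nat. Omega1" UNIV
    by (rule product_prob)
  have I: "{1..Suc n} = insert (Suc n) {1..n}"
    by auto
  have ennreal_sum: "ennreal (potential (Suc n) \<omega>) + ennreal c * of_bool (alive (Suc n) \<omega>)
      = ennreal (potential (Suc n) \<omega> + c * of_bool (alive (Suc n) \<omega>))" for \<omega>
    using c potential_nonneg[of "Suc n" \<omega>] by (cases "alive (Suc n) \<omega>") (simp_all del: alive.simps)
  have "mean_potential (Suc n) + ennreal c * prob_alive (Suc n)
      = (\<integral>\<^sup>+\<omega>. ennreal (potential (Suc n) \<omega>) + ennreal c * of_bool (alive (Suc n) \<omega>) \<partial>histories (Suc n))"
    unfolding mean_potential_def prob_alive_def using measurable_ennreal_potential[OF order_refl] measurable_of_bool_alive[OF order_refl]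
    by (simp add: nn_integral_add nn_integral_cmult del: alive.simps)
  also have "\<dots> = (\<integral>\<^sup>+\<omega>. ennreal (potential (Suc n) \<omega> + c * of_bool (alive (Suc n) \<omega>)) \<partial>histories (Suc n))"
    unfolding ennreal_sum ..
  also have "\<dots> = (\<integral>\<^sup>+x. \<integral>\<^sup>+y. ennreal (potential (Suc n) (x(Suc n := y)) + c * of_bool (alive (Suc n) (x(Suc n := y)))) \<partial>Omega1 \<partial>histories n)"
  proof -
    have "(\<lambda>\<omega>. ennreal (potential (Suc n) \<omega>) + ennreal c * of_bool (alive (Suc n) \<omega>)) \<in> borel_measurable (histories (Suc n))"
      using measurable_ennreal_potential[OF order_refl] measurable_of_bool_alive[OF order_refl] by (intro borel_measurable_add borel_measurable_times_ennreal borel_measurable_const)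
    then have "(\<lambda>\<omega>. ennreal (potential (Suc n) \<omega> + c * of_bool (alive (Suc n) \<omega>))) \<in> borel_measurable (histories (Suc n))"
      unfolding ennreal_sum .
    then show ?thesis
      unfolding I by (intro product_nn_integral_insert) simp_all
  qed
  also have "\<dots> \<le> mean_potential n"
    unfolding mean_potential_def by (intro nn_integral_mono potential_step)
  finally show ?thesis .
qed

text \<open>Telescoping of \<open>mean_potential_Suc\<close>. In particular the expected number of
  turns survived is at most \<open>U p0 / c\<close>.\<close>

lemma mean_potential_le: "mean_potential n + ennreal c * (\<Sum>m=1..n. prob_alive m) \<le> ennreal (U p0)"
proof (induction n)
  case 0
  interpret prob_space "histories 0"
    by (intro prob_space_PiM prob_space_Omega1)
  have "potential 0 \<omega> \<le> U p0" for \<omega>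
    using U(2)[of p0] by (simp add: potential_def)
  then have "ennreal (potential 0 \<omega>) \<le> ennreal (U p0)" for \<omega>
    by (rule ennreal_leI)
  then have "mean_potential 0 \<le> (\<integral>\<^sup>+\<omega>. ennreal (U p0) \<partial>histories 0)"
    unfolding mean_potential_def by (rule nn_integral_mono)
  also have "\<dots> = ennreal (U p0)"
    unfolding nn_integral_const emeasure_space_1 by simp
  finally show ?case
    by simp
next
  case (Suc n)
  have "mean_potential (Suc n) + ennreal c * (\<Sum>m=1..Suc n. prob_alive m)
      = (mean_potential (Suc n) + ennreal c * prob_alive (Suc n)) + ennreal c * (\<Sum>m=1..n. prob_alive m)"
    by (simp add: distrib_left add_ac)
  also have "\<dots> \<le> mean_potential n + ennreal c * (\<Sum>m=1..n. prob_alive m)"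
    by (intro add_right_mono mean_potential_Suc)
  finally show ?case
    using Suc by (rule order_trans)
qed

text \<open>The partial sums of \<open>prob_alive\<close> stay below \<open>1 / c\<close>, so the
  terms cannot all be at least \<eta>.\<close>

lemma exists_prob_alive_less:
  assumes "0 < \<eta>"
  shows "\<exists>n. prob_alive n < ennreal \<eta>"
proof (rule ccontr)
  assume "\<not> ?thesis"
  then have ge: "ennreal \<eta> \<le> prob_alive n" for n
    by (simp add: not_less)
  have "c * (real n * \<eta>) \<le> 1" for n
  proof -
    have "ennreal (c * (real n * \<eta>)) = ennreal c * (\<Sum>m=1..n. ennreal \<eta>)"
      using c assms by (simp add: ennreal_mult ennreal_of_nat_eq_real_of_nat)
    also have "\<dots> \<le> ennreal c * (\<Sum>m=1..n. prob_alive m)"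
      by (intro mult_left_mono sum_mono ge) simp
    also have "\<dots> \<le> ennreal (U p0)"
      using mean_potential_le[of n] by (rule order_trans[rotated]) simp
    also have "\<dots> \<le> ennreal 1"
      using U(3) by (rule ennreal_leI)
    finally show ?thesis
      by (subst (asm) ennreal_le_iff) simp_all
  qed
  moreover obtain n where "1 < real n * (c * \<eta>)"
    using reals_Archimedean3[of "c * \<eta>"] c assms by auto
  ultimately show False
    using not_less by (metis mult.left_commute)
qed

section \<open>The stopping event\<close>

lemma alive_continues: "alive n \<omega> \<Longrightarrow> i < n \<Longrightarrow> continues i \<omega>"
  by (induction n) (auto simp: less_Suc_eq)

lemma stopped_early:
  "\<not> alive n \<omega> \<Longrightarrow> \<not> escaped n \<omega> \<Longrightarrow> \<exists>m<n. alive m \<omega> \<and> \<not> continues m \<omega>"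
proof (induction n)
  case 0
  then show ?case
    using U(3)[of p0] by simp
next
  case (Suc n)
  then show ?case
    using U(3)[of "pos \<omega> (Suc n)"] by (cases "alive n \<omega>") (auto simp: less_Suc_eq)
qed

lemma Inf_enat_image_eq_iff: "Inf (enat ` A) = enat k \<longleftrightarrow> k \<in> A \<and> (\<forall>m\<in>A. k \<le> m)"
proof
  assume *: "Inf (enat ` A) = enat k"
  then have "A \<noteq> {}"
    by (auto simp: top_enat_def)
  then obtain a where "enat a \<in> enat ` A"
    by blast
  then have "(LEAST x. x \<in> enat ` A) \<in> enat ` A"
    by (rule LeastI)
  then have "Inf (enat ` A) \<in> enat ` A"
    using \<open>A \<noteq> {}\<close> by (simp add: Inf_enat_def)
  moreover have "Inf (enat ` A) \<le> enat m" if "m \<in> A" for m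
    using that by (intro Inf_lower) simp
  ultimately show "k \<in> A \<and> (\<forall>m\<in>A. k \<le> m)"
    unfolding * by auto
qed (auto intro!: antisym Inf_lower Inf_greatest)

text \<open>The clock of turn \<open>n + 1\<close> is compared with the threshold at position
  \<open>n\<close>; stopping time \<open>Suc n\<close> therefore belongs to final position
  \<open>n\<close>, in accordance with \<open>n - 1\<close> in \<open>ends_in_ball\<close>.\<close>

lemma stop_time_eq_iff:
  "stop_time D p \<epsilon> p0 (pull S) \<sigma>II \<omega> = enat k \<longleftrightarrow> (\<exists>n. k = Suc n \<and> \<not> continues n \<omega> \<and> (\<forall>i<n. continues i \<omega>))"
proof -
  let ?A = "{n. 1 \<le> n \<and> snd (snd (\<omega> n)) > d_eps D \<epsilon> (pos \<omega> (n - 1))}"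
  have "?A = Suc ` {n. \<not> continues n \<omega>}"
    by (auto simp: not_le image_iff Suc_le_eq gr0_conv_Suc)
  then have "stop_time D p \<epsilon> p0 (pull S) \<sigma>II \<omega> = Inf (enat ` Suc ` {n. \<not> continues n \<omega>})"
    unfolding stop_time_def by simp
  moreover have "k \<in> Suc ` B \<and> (\<forall>m\<in>Suc ` B. k \<le> m) \<longleftrightarrow> (\<exists>n. k = Suc n \<and> n \<in> B \<and> (\<forall>i<n. i \<notin> B))" for B
    by (cases k) (auto simp flip: not_less)
  ultimately show ?thesis
    by (simp only: Inf_enat_image_eq_iff mem_Collect_eq not_not)
qed

lemma ends_in_ball_eq:
  "ends_in_ball D p \<epsilon> p0 (pull S) \<sigma>II q0 \<delta>
    = {\<omega> \<in> space Omega. \<exists>n. \<not> continues n \<omega> \<and> (\<forall>i\<in>{..<n}. continues i \<omega>) \<and> pos \<omega> n \<in> hball q0 \<delta>}"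
proof -
  have *: "(\<exists>k. (\<exists>n. k = Suc n \<and> A n \<and> C n) \<and> B (k - 1)) \<longleftrightarrow> (\<exists>n. A n \<and> C n \<and> B n)"
    for A B C :: "nat \<Rightarrow> bool"
    by (metis diff_Suc_1)
  show ?thesis
    unfolding ends_in_ball_def stop_time_eq_iff
  proof (intro Collect_cong conj_cong refl)
    fix \<omega>
    show "(\<exists>k. (\<exists>n. k = Suc n \<and> \<not> continues n \<omega> \<and> (\<forall>i<n. continues i \<omega>)) \<and> pos \<omega> (k - 1) \<in> hball q0 \<delta>)
        \<longleftrightarrow> (\<exists>n. \<not> continues n \<omega> \<and> (\<forall>i\<in>{..<n}. continues i \<omega>) \<and> pos \<omega> n \<in> hball q0 \<delta>)"
      using *[of "\<lambda>n. \<not> continues n \<omega>" "\<lambda>n. \<forall>i<n. continues i \<omega>" "\<lambda>n. pos \<omega> n \<in> hball q0 \<delta>"] by (simp add: Ball_def)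
  qed
qed

lemma sets_ends_in_ball: "ends_in_ball D p \<epsilon> p0 (pull S) \<sigma>II q0 \<delta> \<in> sets Omega"
proof -
  have "Measurable.pred Omega (\<lambda>\<omega>. continues n \<omega>)" for n
    unfolding Omega_def by (rule measurable_continues) auto
  moreover have "Measurable.pred Omega (\<lambda>\<omega>. pos \<omega> n \<in> hball q0 \<delta>)" for n
    unfolding Omega_def by (rule measurable_compose[OF measurable_pos]) (auto simp: pred_def)
  ultimately show ?thesis
    unfolding ends_in_ball_eq pred_def[symmetric]
    by (intro pred_intros_countable pred_intros_logic pred_intros_finite) auto
qed

text \<open>Restriction to the first \<open>n\<close> coordinates maps \<open>Omega\<close> to the
  finite product measure, and \<open>cong\<close> says that \<open>f\<close> sees only these
  coordinates.\<close>

lemma nn_integral_Omega: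
  fixes f :: "(nat \<Rightarrow> outcome) \<Rightarrow> ennreal"
  assumes f: "f \<in> borel_measurable (histories n)" and cong: "\<And>\<omega>. f (restrict \<omega> {1..n}) = f \<omega>"
  shows "(\<integral>\<^sup>+\<omega>. f \<omega> \<partial>Omega) = (\<integral>\<^sup>+\<omega>. f \<omega> \<partial>histories n)"
proof -
  interpret product_prob_space "\<lambda>_ :: nat. Omega1" "{1..}"
    by (rule product_prob)
  have "distr Omega (histories n) (\<lambda>\<omega>. restrict \<omega> {1..n}) = histories n"
    unfolding Omega_def by (intro distr_PiM_restrict_finite) auto
  then have "(\<integral>\<^sup>+\<omega>. f \<omega> \<partial>histories n) = (\<integral>\<^sup>+\<omega>. f \<omega> \<partial>distr Omega (histories n) (\<lambda>\<omega>. restrict \<omega> {1..n}))"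
    by simp
  also have "\<dots> = (\<integral>\<^sup>+\<omega>. f (restrict \<omega> {1..n}) \<partial>Omega)"
    unfolding Omega_def by (rule nn_integral_distr[OF measurable_restrict_subset]) (force, simp only: measurable_distr_eq1 f)
  finally show ?thesis
    unfolding cong by simp
qed

text \<open>For every \<open>n\<close>, failure of player I, including a game that never stops,
  means escaped or alive at time \<open>n\<close>. The mean potential, at most \<open>U p0\<close>,
  pays for the former; \<open>n\<close> is chosen so that the latter has probability below
  \<open>\<eta> - U p0\<close>.\<close>

lemma prob_ends_in_ball:
  assumes ball: "\<And>q. U q < 1 \<Longrightarrow> q \<in> hball q0 \<delta>" and \<eta>: "U p0 < \<eta>"
  shows "1 - \<eta> \<le> measure Omega (ends_in_ball D p \<epsilon> p0 (pull S) \<sigma>II q0 \<delta>)"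
proof -
  let ?E = "ends_in_ball D p \<epsilon> p0 (pull S) \<sigma>II q0 \<delta>"
  interpret prob_space Omega
    unfolding Omega_def by (intro prob_space_PiM prob_space_Omega1)
  obtain n where n: "prob_alive n < ennreal (\<eta> - U p0)"
    using exists_prob_alive_less[of "\<eta> - U p0"] \<eta> by auto
  have "alive n \<omega> \<or> escaped n \<omega>" if "\<omega> \<in> space Omega - ?E" for \<omega>
  proof (rule ccontr)
    assume "\<not> ?thesis"
    then obtain m where m: "alive m \<omega>" "\<not> continues m \<omega>"
      using stopped_early by blast
    then have "pos \<omega> m \<in> hball q0 \<delta>" "\<forall>i\<in>{..<m}. continues i \<omega>"
      using ball alive_less_1 alive_continues by auto
    then show False
      using that m unfolding ends_in_ball_eq by blast
  qed
  then have ind: "indicator (space Omega - ?E) \<omega> \<le> ennreal (potential n \<omega>) + of_bool (alive n \<omega>)" for \<omega>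
    by (auto simp: indicator_def potential_def)
  have "emeasure Omega (space Omega - ?E) = (\<integral>\<^sup>+\<omega>. indicator (space Omega - ?E) \<omega> \<partial>Omega)"
    by (intro nn_integral_indicator[symmetric] sets.compl_sets sets_ends_in_ball)
  also have "\<dots> \<le> (\<integral>\<^sup>+\<omega>. ennreal (potential n \<omega>) + of_bool (alive n \<omega>) \<partial>Omega)"
    using ind by (rule nn_integral_mono)
  also have "\<dots> = (\<integral>\<^sup>+\<omega>. ennreal (potential n \<omega>) + of_bool (alive n \<omega>) \<partial>histories n)"
  proof (rule nn_integral_Omega)
    fix \<omega>
    have "potential n (restrict \<omega> {1..n}) = potential n \<omega>" "alive n (restrict \<omega> {1..n}) = alive n \<omega>"
      by (rule potential_cong alive_cong; simp)+
    then show "ennreal (potential n (restrict \<omega> {1..n})) + of_bool (alive n (restrict \<omega> {1..n}))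
        = ennreal (potential n \<omega>) + of_bool (alive n \<omega>)"
      by simp
  qed (intro borel_measurable_add measurable_ennreal_potential measurable_of_bool_alive order_refl)
  also have "\<dots> = mean_potential n + prob_alive n"
    unfolding mean_potential_def prob_alive_def
    by (intro nn_integral_add measurable_ennreal_potential measurable_of_bool_alive order_refl)
  also have "\<dots> \<le> ennreal (U p0) + ennreal (\<eta> - U p0)"
    using mean_potential_le[of n] n by (intro add_mono) (auto intro: order_trans[rotated])
  also have "\<dots> = ennreal \<eta>"
    using U(2)[of p0] \<eta> by (simp add: ennreal_plus[symmetric] del: ennreal_plus)
  finally have "prob (space Omega - ?E) \<le> \<eta>"
    using U(2)[of p0] \<eta> by (simp add: emeasure_eq_measure)
  then show ?thesis
    using prob_compl[OF sets_ends_in_ball] by simp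
qed

end

theorem theorem14p5:
  fixes p :: real and D :: "heis set" and q0 :: heis
  assumes "p > 2"
    and "open D" and "bounded D" and "connected D"
    and "q0 \<in> frontier D"
    and "exterior_corkscrew D q0"
  shows "game_regular p D q0"
  unfolding game_regular_def
proof (intro allI impI)
  fix \<eta> \<delta> :: real assume pos: "0 < \<eta>" "0 < \<delta>"
  have D: "D \<noteq> UNIV"
    using assms(3) not_bounded_UNIV by blast
  have g: "0 \<le> gamma_p p"
    using assms(1) by (simp add: gamma_p_def)
  \<comment> \<open>Halving \<eta> here and \<open>r\<close> below turns the weak bounds in
    \<open>barrier\<close> into the strict ones required.\<close>
  obtain U r where bar: "barrier D (gamma_p p) q0 \<delta> (\<eta> / 2) U r"
    using barrier_exists[OF assms(6) g pos(2), of "\<eta> / 2"] pos by auto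
  then obtain e0 where e0: "0 < e0" "\<And>e. 0 < e \<Longrightarrow> e < e0 \<Longrightarrow> \<exists>S c. strict_step D (gamma_p p) e U S c"
    by (auto simp: barrier_def)
  have r: "r / 2 \<in> {0<..<\<delta>}"
    using bar by (auto simp: barrier_def)
  have "\<exists>\<sigma>I. is_strategy \<sigma>I \<and> (\<forall>\<sigma>II. is_strategy \<sigma>II \<longrightarrow>
      1 - \<eta> \<le> measure Omega (ends_in_ball D p \<epsilon> p0 \<sigma>I \<sigma>II q0 \<delta>))"
    if \<epsilon>: "\<epsilon> \<in> {0<..<min e0 (1 / 2)}" and p0: "p0 \<in> hball q0 (r / 2)" for \<epsilon> p0
  proof -
    obtain S c where S: "strict_step D (gamma_p p) \<epsilon> U S c"
      using e0(2)[of \<epsilon>] \<epsilon> by auto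
    have "p0 \<in> hball q0 r"
      using p0 bar by (auto simp: hball_def barrier_def)
    then have "U p0 \<le> \<eta> / 2"
      using bar unfolding barrier_def by blast
    then have less: "U p0 < \<eta>"
      using pos by simp
    have "is_strategy (pull S)"
      using S by (intro is_strategy_pull) (auto simp: strict_step_def)
    moreover have "1 - \<eta> \<le> measure Omega (ends_in_ball D p \<epsilon> p0 (pull S) \<sigma>II q0 \<delta>)"
      if "is_strategy \<sigma>II" for \<sigma>II
    proof -
      interpret barrier_game p \<epsilon> c D p0 U S \<sigma>II
        using \<epsilon> D bar S that by unfold_locales (auto simp: barrier_def)
      show ?thesis
        using bar less by (intro prob_ends_in_ball) (auto simp: barrier_def)
    qed
    ultimately show ?thesis
      by blast
  qed
  moreover have "min e0 (1 / 2) \<in> {0<..<1}"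
    using e0(1) by auto
  ultimately show "\<exists>\<delta>'\<in>{0<..<\<delta>}. \<exists>\<epsilon>'\<in>{0<..<1}. \<forall>\<epsilon>\<in>{0<..<\<epsilon>'}. \<forall>p0\<in>hball q0 \<delta>'.
      \<exists>\<sigma>I. is_strategy \<sigma>I \<and> (\<forall>\<sigma>II. is_strategy \<sigma>II \<longrightarrow>
        1 - \<eta> \<le> measure Omega (ends_in_ball D p \<epsilon> p0 \<sigma>I \<sigma>II q0 \<delta>))"
    using r by blast
qed

end
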